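(* Let $N\ge 2$ and $p>q>1$, and let $m>q$. Let $g:\mathbb R\to\mathbb R$ be continuous and let $f:\mathbb R\times\mathbb R^N\to\mathbb R$ be a continuous function satisfying $|f(t,\xi)|\leq g(t)|\xi|^m$ for all $(t,\xi)\in\mathbb R\times\mathbb R^N$. Then every bounded solution $u$ of $$-\Delta_pu-\Delta_q u=f(u,\nabla u)\quad\text{in }\mathbb R^N$$ is constant.
   Context: $\Delta_r u=\mathrm{div}(|\nabla u|^{r-2}\nabla u)$ denotes the $r$-Laplacian. A solution of $-\Delta_p u-\Delta_q u=f(u,\nabla u)$ in $\mathbb R^N$ means a function $u\in C^1(\mathbb R^N)$ such that $\int |\nabla u|^{p-2}\nabla u\cdot\nabla\varphi\,dx+\int|\nabla u|^{q-2}\nabla u\cdot\nabla\varphi\,dx=\int f(u,\nabla u)\varphi\,dx$ for all $\varphi\in C^1_c(\mathbb R^N)$. No sign condition is imposed on $u$. *)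

theory Defs
  imports "HOL-Analysis.Analysis"
begin

definition C1_with_grad :: "(real^'n \<Rightarrow> real) \<Rightarrow> (real^'n \<Rightarrow> real^'n) \<Rightarrow> bool" where
  "C1_with_grad u Du \<longleftrightarrow>
     (\<forall>x. (u has_derivative (\<lambda>h. Du x \<bullet> h)) (at x)) \<and> continuous_on UNIV Du"

definition C1c_test :: "(real^'n \<Rightarrow> real) \<Rightarrow> (real^'n \<Rightarrow> real^'n) \<Rightarrow> bool" where
  "C1c_test \<phi> D\<phi> \<longleftrightarrow> C1_with_grad \<phi> D\<phi> \<and> compact (closure {x. \<phi> x \<noteq> 0})"

text \<open>Weak (distributional) solution of -Delta_p u - Delta_q u = f(u, grad u) in R^N,
  for u in C^1 with gradient Du.\<close>
definition pq_laplace_solution ::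
  "real \<Rightarrow> real \<Rightarrow> (real \<Rightarrow> real^'n \<Rightarrow> real) \<Rightarrow> (real^'n \<Rightarrow> real) \<Rightarrow> (real^'n \<Rightarrow> real^'n) \<Rightarrow> bool" where
  "pq_laplace_solution p q f u Du \<longleftrightarrow>
     C1_with_grad u Du \<and>
     (\<forall>\<phi> D\<phi>. C1c_test \<phi> D\<phi> \<longrightarrow>
        (\<integral>x. (norm (Du x) powr (p - 2)) * (Du x \<bullet> D\<phi> x) \<partial>lborel)
      + (\<integral>x. (norm (Du x) powr (q - 2)) * (Du x \<bullet> D\<phi> x) \<partial>lborel)
      = (\<integral>x. f (u x) (Du x) * \<phi> x \<partial>lborel))"

end

theory Submission
  imports Defs
begin

text \<open>
  Doubling of variables in the spirit of Ishii and Lions. Put \<open>\<beta> = m - q + 1 > 1\<close> and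
  \<open>\<alpha> = 1 - 1/\<beta>\<close>. For every small \<open>\<kappa>\<close> one has \<open>u x - u y \<le> \<kappa> |x - y|\<^sup>\<alpha>\<close>, and \<open>\<kappa> \<rightarrow> 0\<close> makes \<open>u\<close> constant.
  Otherwise \<open>u x - u y - \<kappa> |x - y|\<^sup>\<alpha> - \<epsilon> |x|\<^sup>2\<close> has a positive maximum, at a point with \<open>x \<noteq> y\<close>.
  There the gradients of \<open>u\<close> at \<open>x\<close> and \<open>y\<close> both have size about \<open>w = \<kappa> \<alpha> r powr (\<alpha> - 1)\<close>, where \<open>r = |x - y|\<close>.
  Moving \<open>x\<close> and \<open>y\<close> in parallel orthogonally to \<open>x - y\<close> and in opposite directions along it,
  the concave penalty contributes a negative term of order \<open>w powr (q - 1) / r\<close>,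
  while the right-hand sides are of order \<open>w powr m = (\<kappa> \<alpha>) powr \<beta> * w powr (q - 1) / r\<close>,
  which is smaller when \<open>\<kappa>\<close> is small: a contradiction.

  As \<open>u\<close> is only \<open>C\<^sup>1\<close>, the second-order comparison at the maximum is replaced by testing the weak
  equation, in each variable separately, with the square of the positive part of the doubled
  function near its strict maximum. The coupling of the two variables is carried by a constant
  matrix \<open>B\<close>, since the mixed term \<open>B (Du y) \<bullet> D\<^sub>x \<phi>\<close> integrates to zero over \<open>x\<close>.
\<close>

section \<open>Integration against compactly supported functions\<close>

lemma integrable_compact_support:
  fixes f :: "'a::euclidean_space \<Rightarrow> 'b::{banach, second_countable_topology}"
  assumes "compact K" "continuous_on K f" "\<And>x. x \<notin> K \<Longrightarrow> f x = 0"
  shows "integrable lborel f"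
proof -
  have "f = (\<lambda>x. indicator K x *\<^sub>R f x)"
    using assms(3) by (auto simp: fun_eq_iff indicator_def)
  then show ?thesis
    using borel_integrable_compact[OF assms(1,2)] by metis
qed

lemma has_derivative_zero_outside:
  fixes f :: "'a::real_normed_vector \<Rightarrow> 'b::real_normed_vector"
  assumes "closed K" "\<And>x. x \<notin> K \<Longrightarrow> f x = 0" "x \<notin> K"
  shows "(f has_derivative (\<lambda>h. 0)) (at x)"
proof (rule has_derivative_transform_within_open[where s = "- K" and f = "\<lambda>_. 0"])
  show "((\<lambda>_. 0) has_derivative (\<lambda>h. 0)) (at x)" by simp
qed (use assms in auto)

text \<open>Translation invariance of Lebesgue measure makes every difference quotient of
  \<open>h\<close> along \<open>b\<close> integrate to zero; dominated convergence passes this on to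
  the directional derivative.\<close>

lemma integral_derivative_compact_support:
  fixes h :: "'a::euclidean_space \<Rightarrow> real"
  assumes der: "\<And>x. (h has_derivative h' x) (at x)"
    and cont: "continuous_on UNIV (\<lambda>x. h' x b)"
    and K: "compact K" "\<And>x. x \<notin> K \<Longrightarrow> h x = 0"
  shows "(\<integral>x. h' x b \<partial>lborel) = 0"
proof -
  have h'0: "h' x b = 0" if "x \<notin> K" for x
    using has_derivative_unique[OF der has_derivative_zero_outside[OF compact_imp_closed[OF K(1)] K(2) that]]
    by simp
  have conth: "continuous_on UNIV h"
    using der has_derivative_continuous_on by blast
  obtain C where C: "\<And>x. \<bar>h' x b\<bar> \<le> C"
  proof -
    have "compact ((\<lambda>x. h' x b) ` K)"
      using K(1) cont continuous_on_subset by (blast intro: compact_continuous_image)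
    then obtain C where "\<forall>x\<in>K. norm (h' x b) \<le> C"
      by (auto dest!: compact_imp_bounded simp: bounded_iff)
    then have "\<bar>h' x b\<bar> \<le> max C 0" for x
      using h'0[of x] by (cases "x \<in> K") (auto simp: le_max_iff_disj)
    then show ?thesis using that by blast
  qed
  obtain r where r: "\<And>x. x \<in> K \<Longrightarrow> norm x \<le> r"
    using compact_imp_bounded[OF K(1)] by (auto simp: bounded_iff)
  define t where "t n = inverse (real (Suc n))" for n
  have t: "t n > 0" "t n \<le> 1" for n
    by (auto simp: t_def divide_simps)
  have t0: "t \<longlonglongrightarrow> 0"
    unfolding t_def by (rule LIMSEQ_inverse_real_of_nat)
  have inth: "integrable lborel h"
    using K conth by (intro integrable_compact_support[of K]) (auto intro: continuous_on_subset)
  define s where "s n x = (h (x + t n *\<^sub>R b) - h x) / t n" for n x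
  \<comment> \<open>The mean value theorem bounds the difference quotients uniformly by
    \<open>C\<close>, which supplies the dominating function.\<close>
  have diff: "\<bar>h (x + c *\<^sub>R b) - h x\<bar> \<le> C * c" if "c > 0" for x c
  proof -
    have "\<exists>z. z > 0 \<and> z < c \<and> h (x + c *\<^sub>R b) - h (x + 0 *\<^sub>R b) = (c - 0) * h' (x + z *\<^sub>R b) b"
    proof (rule MVT2[OF that, of "\<lambda>z. h (x + z *\<^sub>R b)" "\<lambda>z. h' (x + z *\<^sub>R b) b"])
      fix z assume "0 \<le> z" "z \<le> c"
      have "((\<lambda>z. h (x + z *\<^sub>R b)) has_derivative (\<lambda>y. h' (x + z *\<^sub>R b) (y *\<^sub>R b))) (at z)"
        by (rule has_derivative_compose[OF _ der]) (auto intro!: derivative_eq_intros)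
      moreover have "h' (x + z *\<^sub>R b) (y *\<^sub>R b) = y * h' (x + z *\<^sub>R b) b" for y
        using linear_scale[OF has_derivative_linear[OF der]] by simp
      ultimately show "((\<lambda>z. h (x + z *\<^sub>R b)) has_real_derivative h' (x + z *\<^sub>R b) b) (at z)"
        by (simp add: has_field_derivative_def mult_commute_abs)
    qed
    then obtain z where "h (x + c *\<^sub>R b) - h x = c * h' (x + z *\<^sub>R b) b" by auto
    then show ?thesis using C[of "x + z *\<^sub>R b"] that by (simp add: abs_mult mult.commute)
  qed
  have int0: "(\<integral>x. s n x \<partial>lborel) = 0" for n
  proof -
    have "(\<integral>x. h (t n *\<^sub>R b + x) \<partial>lborel) = (\<integral>x. h x \<partial>distr lborel borel ((+) (t n *\<^sub>R b)))"
      using conth by (subst integral_distr) (auto intro: borel_measurable_continuous_onI)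
    then have a: "(\<integral>x. h (x + t n *\<^sub>R b) \<partial>lborel) = (\<integral>x. h x \<partial>lborel)"
      by (simp add: lborel_distr_plus add.commute)
    have "integrable (distr lborel borel ((+) (t n *\<^sub>R b))) h"
      using inth by (simp add: lborel_distr_plus)
    then have b: "integrable lborel (\<lambda>x. h (x + t n *\<^sub>R b))"
      by (subst (asm) integrable_distr_eq) (auto simp: add.commute conth borel_measurable_continuous_onI)
    show ?thesis
      unfolding s_def using a b inth by simp
  qed
  \<comment> \<open>Since \<open>t n \<le> 1\<close>, a translate by \<open>t n *\<^sub>R b\<close>
    moves points by at most \<open>norm b\<close>, so all quotients vanish outside the ball of
    radius \<open>r + norm b\<close>.\<close>
  have "(\<lambda>n. \<integral>x. s n x \<partial>lborel) \<longlonglongrightarrow> (\<integral>x. h' x b \<partial>lborel)"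
  proof (rule integral_dominated_convergence[where w = "\<lambda>x. C * indicator (cball 0 (r + norm b)) x"])
    show "(\<lambda>x. h' x b) \<in> borel_measurable lborel"
      using cont by (simp add: borel_measurable_continuous_onI)
    show "s n \<in> borel_measurable lborel" for n
      unfolding s_def
      by (simp, intro borel_measurable_continuous_onI continuous_intros continuous_on_compose2[OF conth])
        (use t in \<open>auto simp: less_imp_neq[symmetric]\<close>)
    show "integrable lborel (\<lambda>x. C * indicator (cball 0 (r + norm b)) x :: real)"
      by (intro integrable_mult_right integrable_real_indicator)
        (use emeasure_bounded_finite[OF bounded_cball] in auto)
    show "AE x in lborel. (\<lambda>n. s n x) \<longlonglongrightarrow> h' x b"
    proof (rule AE_I2)
      fix x
      have "((\<lambda>z. h (x + z *\<^sub>R b)) has_derivative (\<lambda>y. h' (x + 0 *\<^sub>R b) (y *\<^sub>R b))) (at 0)"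
        by (rule has_derivative_compose[OF _ der]) (auto intro!: derivative_eq_intros)
      moreover have "h' x (y *\<^sub>R b) = y * h' x b" for y
        using linear_scale[OF has_derivative_linear[OF der]] by simp
      ultimately have "((\<lambda>z. h (x + z *\<^sub>R b)) has_real_derivative h' x b) (at 0)"
        by (simp add: has_field_derivative_def mult_commute_abs)
      then have "((\<lambda>z. (h (x + z *\<^sub>R b) - h x) / z) \<longlongrightarrow> h' x b) (at 0)"
        by (simp add: has_field_derivative_iff)
      moreover have "filterlim t (at 0) sequentially"
        using t0 t by (auto simp: filterlim_at less_imp_neq[symmetric])
      ultimately show "(\<lambda>n. s n x) \<longlonglongrightarrow> h' x b"
        unfolding s_def by (rule filterlim_compose)
    qed
    show "AE x in lborel. norm (s n x) \<le> C * indicator (cball 0 (r + norm b)) x" for n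
    proof (rule AE_I2)
      fix x
      show "norm (s n x) \<le> C * indicator (cball 0 (r + norm b)) x"
      proof (cases "norm x \<le> r + norm b")
        case True
        then show ?thesis
          using diff[of "t n" x] t[of n] by (auto simp: s_def divide_simps mult.commute)
      next
        case False
        have "norm (t n *\<^sub>R b) \<le> norm b"
          using t[of n] by (simp add: mult_left_le_one_le)
        moreover have "norm x \<le> norm (x + t n *\<^sub>R b) + norm (t n *\<^sub>R b)"
          by (metis add_diff_cancel norm_triangle_ineq4)
        ultimately have "x + t n *\<^sub>R b \<notin> K" 
          using False r[of "x + t n *\<^sub>R b"] by force
        moreover have "x \<notin> K" using False r[of x] norm_ge_zero[of b] by linarith
        ultimately show ?thesis using False K(2) by (simp add: s_def)
      qed
    qed
  qed
  then show ?thesis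
    by (simp add: int0 LIMSEQ_const_iff)
qed

text \<open>Integration by parts, one coordinate at a time: the derivative of
  \<open>(V x \<bullet> b) * p x\<close> along \<open>b\<close> integrates to zero. Smoothness of
  \<open>V\<close> is asked only on a neighbourhood \<open>U\<close> of the support, because the
  fields used later are singular at the origin.\<close>

lemma integral_inner_gradient_compact_support:
  fixes V :: "'a::euclidean_space \<Rightarrow> 'a"
  assumes V: "\<And>x. x \<in> U \<Longrightarrow> (V has_derivative V' x) (at x)"
    and cV: "\<And>b. continuous_on U (\<lambda>x. V' x b)"
    and U: "open U" "K \<subseteq> U"
    and p: "\<And>x. (p has_derivative (\<lambda>h. Dp x \<bullet> h)) (at x)" "continuous_on UNIV Dp"
    and K: "compact K" "\<And>x. x \<notin> K \<Longrightarrow> p x = 0"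
  shows "(\<integral>x. V x \<bullet> Dp x \<partial>lborel) = - (\<integral>x. (\<Sum>b\<in>Basis. V' x b \<bullet> b) * p x \<partial>lborel)"
proof -
  have Dp0: "Dp x = 0" if "x \<notin> K" for x
  proof -
    have "(\<lambda>h. Dp x \<bullet> h) = (\<lambda>h. 0)"
      by (rule has_derivative_unique[OF p(1) has_derivative_zero_outside[OF compact_imp_closed[OF K(1)] K(2) that]])
    then show ?thesis by (metis inner_eq_zero_iff)
  qed
  have cp: "continuous_on A p" for A
    by (rule has_derivative_continuous_on[OF has_derivative_at_withinI[OF p(1)]])
  have cVV: "continuous_on U V"
    by (rule has_derivative_continuous_on[OF has_derivative_at_withinI[OF V]])
  define d where "d b x h = (V' x h \<bullet> b) * p x + (V x \<bullet> b) * (Dp x \<bullet> h)" for b x h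
  have zero: "(\<integral>x. d b x b \<partial>lborel) = 0" for b
  proof (rule integral_derivative_compact_support[where h = "\<lambda>x. (V x \<bullet> b) * p x" and h' = "d b" and K = K])
    show "((\<lambda>x. V x \<bullet> b * p x) has_derivative d b x) (at x)" for x
    proof (cases "x \<in> K")
      case True
      then have "(V has_derivative V' x) (at x)" using V U by auto
      from has_derivative_mult[OF has_derivative_inner_left[OF this] p(1)]
      show ?thesis unfolding d_def by (simp add: algebra_simps)
    next
      case False
      moreover have "d b x = (\<lambda>h. 0)"
        using False Dp0 K(2) by (simp add: d_def fun_eq_iff)
      ultimately show ?thesis
        using has_derivative_zero_outside[OF compact_imp_closed[OF K(1)], of "\<lambda>x. V x \<bullet> b * p x" x] K(2) by simp
    qed
    \<comment> \<open>Global continuity is glued from the open sets \<open>U\<close> and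
      \<open>- K\<close>, which cover the space; on \<open>- K\<close> everything vanishes.\<close>
    have "continuous_on U (\<lambda>x. d b x b)"
      unfolding d_def using cV cVV cp p(2)
      by (auto intro!: continuous_intros intro: continuous_on_subset)
    moreover have "continuous_on (- K) (\<lambda>x. d b x b)"
      by (rule continuous_on_eq[where f = "\<lambda>x. 0"]) (auto simp: d_def Dp0 K(2))
    ultimately have "continuous_on (U \<union> - K) (\<lambda>x. d b x b)"
      using U(1) K(1) by (intro continuous_on_open_Un) (auto simp: compact_imp_closed)
    moreover have "U \<union> - K = UNIV" using U(2) by auto
    ultimately show "continuous_on UNIV (\<lambda>x. d b x b)" by simp
  qed (use K in auto)
  have i1: "integrable lborel (\<lambda>x. (V' x b \<bullet> b) * p x)" for b
    by (rule integrable_compact_support[OF K(1)])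
      (auto simp: K(2) intro!: continuous_intros cp continuous_on_subset[OF cV U(2)])
  have i2: "integrable lborel (\<lambda>x. (V x \<bullet> b) * (Dp x \<bullet> b))" for b
    by (rule integrable_compact_support[OF K(1)])
      (auto simp: Dp0 intro!: continuous_intros continuous_on_subset[OF cVV U(2)] continuous_on_subset[OF p(2)])
  have "(\<integral>x. V x \<bullet> Dp x \<partial>lborel) = (\<Sum>b\<in>Basis. \<integral>x. (V x \<bullet> b) * (Dp x \<bullet> b) \<partial>lborel)"
    by (subst euclidean_inner) (rule Bochner_Integration.integral_sum, rule i2)
  also have "\<dots> = (\<Sum>b\<in>Basis. - (\<integral>x. (V' x b \<bullet> b) * p x \<partial>lborel))"
  proof (rule sum.cong)
    fix b :: 'a
    have "(\<integral>x. (V' x b \<bullet> b) * p x \<partial>lborel) + (\<integral>x. (V x \<bullet> b) * (Dp x \<bullet> b) \<partial>lborel) = 0"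
      using zero[of b] i1[of b] i2[of b] unfolding d_def by simp
    then show "(\<integral>x. (V x \<bullet> b) * (Dp x \<bullet> b) \<partial>lborel) = - (\<integral>x. (V' x b \<bullet> b) * p x \<partial>lborel)" by simp
  qed simp
  also have "\<dots> = - (\<integral>x. (\<Sum>b\<in>Basis. V' x b \<bullet> b) * p x \<partial>lborel)"
    using i1 by (simp add: sum_distrib_right sum_negf)
  finally show ?thesis .
qed

text \<open>The positive part has a corner at 0; its square does not, since
  \<open>(max 0 s)\<^sup>2 / s\<close> is bounded by \<open>\<bar>s\<bar>\<close>. Squaring
  therefore yields an admissible C^1 test function.\<close>

lemma has_derivative_square_positive_part:
  assumes "(g has_derivative g') (at x)"
  shows "((\<lambda>x. (max 0 (g x :: real))\<^sup>2) has_derivative (\<lambda>h. 2 * max 0 (g x) * g' h)) (at x)"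
proof -
  have D: "((\<lambda>t::real. (max 0 t)\<^sup>2) has_real_derivative 2 * max 0 t) (at t)" for t
  proof -
    consider "t > 0" | "t < 0" | "t = 0" by linarith
    then show ?thesis
    proof cases
      case 1
      have "((\<lambda>t::real. t\<^sup>2) has_real_derivative 2 * max 0 t) (at t)"
        using 1 by (auto intro!: derivative_eq_intros)
      then show ?thesis
        by (rule has_field_derivative_transform_within_open[where S = "{0<..}"]) (use 1 in auto)
    next
      case 2
      have "((\<lambda>t::real. 0) has_real_derivative 2 * max 0 t) (at t)"
        using 2 by simp
      then show ?thesis
        by (rule has_field_derivative_transform_within_open[where S = "{..<0}"]) (use 2 in auto)
    next
      case 3
      have "((\<lambda>s::real. (max 0 s)\<^sup>2 / s) \<longlongrightarrow> 0) (at 0)"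
      proof (rule tendsto_rabs_zero_cancel, rule tendsto_sandwich[where f = "\<lambda>_. 0" and h = "\<lambda>s. \<bar>s\<bar>"])
        show "\<forall>\<^sub>F s in at (0::real). \<bar>(max 0 s)\<^sup>2 / s\<bar> \<le> \<bar>s\<bar>"
          by (auto simp: eventually_at_filter power2_eq_square max_def)
        show "((\<lambda>s::real. \<bar>s\<bar>) \<longlongrightarrow> 0) (at 0)"
          by (rule tendsto_rabs_zero) simp
      qed auto
      then show ?thesis using 3 by (simp add: has_field_derivative_iff)
    qed
  qed
  have "((\<lambda>t::real. (max 0 t)\<^sup>2) has_derivative (*) (2 * max 0 (g x))) (at (g x))"
    using D[of "g x"] by (simp add: has_field_derivative_def)
  from has_derivative_compose[OF assms this] show ?thesis by simp
qed

lemma continuous_on_zero_outside: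
  fixes f :: "'a::topological_space \<Rightarrow> 'b::{topological_space,zero}"
  assumes "open X" "closed K" "K \<subseteq> X" "continuous_on X f" "\<And>x. x \<notin> K \<Longrightarrow> f x = 0"
  shows "continuous_on UNIV f"
proof -
  have "continuous_on (- K) f"
    by (rule continuous_on_eq[where f = "\<lambda>_. 0"]) (use assms in auto)
  then have "continuous_on (X \<union> - K) f"
    using assms by (intro continuous_on_open_Un) auto
  moreover have "X \<union> - K = UNIV" using assms by auto
  ultimately show ?thesis by simp
qed

text \<open>Allows the x-equations integrated over y and the y-equations integrated over x to be
  added as integrals over the product space.\<close>

lemma iterated_integrals_agree:
  fixes f :: "'a::euclidean_space \<Rightarrow> 'b::euclidean_space \<Rightarrow> real"
  assumes "integrable lborel (\<lambda>z. f (fst z) (snd z))"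
  shows "(\<integral>y. \<integral>x. f x y \<partial>lborel \<partial>lborel) = (\<integral>z. f (fst z) (snd z) \<partial>lborel)" (is ?A)
    and "(\<integral>x. \<integral>y. f x y \<partial>lborel \<partial>lborel) = (\<integral>z. f (fst z) (snd z) \<partial>lborel)" (is ?B)
proof -
  have *: "integrable (lborel \<Otimes>\<^sub>M lborel) (case_prod f)"
    using assms by (simp add: lborel_prod case_prod_unfold)
  show ?A using lborel_pair.integral_snd[OF *] by (simp add: lborel_prod case_prod_unfold)
  show ?B using lborel_pair.integral_fst[OF *] by (simp add: lborel_prod case_prod_unfold)
qed

text \<open>A vanishing integral would force \<open>f = 0\<close> almost everywhere and make
  \<open>S\<close> null, which a nonempty open set is not.\<close>

lemma integral_nonpos_neg_on_open:
  fixes f :: "'a::euclidean_space \<Rightarrow> real"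
  assumes "integrable lborel f" "\<And>x. f x \<le> 0" "open S" "S \<noteq> {}" "\<And>x. x \<in> S \<Longrightarrow> f x < 0"
  shows "(\<integral>x. f x \<partial>lborel) < 0"
proof (rule ccontr)
  assume "\<not> ?thesis"
  moreover have "(\<integral>x. - f x \<partial>lborel) \<ge> 0"
    using assms(2) by (intro integral_nonneg_AE) simp
  ultimately have "(\<integral>x. - f x \<partial>lborel) = 0" by simp
  then have "AE x in lborel. - f x = 0"
    using assms by (subst (asm) integral_nonneg_eq_0_iff_AE) auto
  then have "AE x in lborel. x \<notin> S"
    by (rule AE_mp) (use assms(5) in \<open>force intro!: AE_I2\<close>)
  then have "S \<in> null_sets lborel"
    using assms(3) by (subst (asm) AE_iff_null_sets[symmetric]) auto
  then have "negligible S"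
    by (simp add: negligible_iff_null_sets null_sets_completionI)
  then show False using open_not_negligible assms by blast
qed

section \<open>Doubling of variables in weak form\<close>

text \<open>
  Here \<open>w x y = u x - u y - \<Theta> x y\<close> up to a constant, with \<open>P\<close> and \<open>- Q\<close> the partial gradients of \<open>\<Theta>\<close>.
\<close>

lemma no_weak_two_point_contact:
  fixes A Du :: "'a::euclidean_space \<Rightarrow> 'a" and w :: "'a \<Rightarrow> 'a \<Rightarrow> real"
    and P Q :: "'a \<Rightarrow> 'a \<Rightarrow> 'a" and AP QX AQ :: "'a \<Rightarrow> 'a \<Rightarrow> 'a \<Rightarrow> 'a"
  assumes cDu: "continuous_on UNIV Du" and cA: "continuous_on UNIV A" and cF: "continuous_on UNIV F"
    and weak: "\<And>\<phi> D\<phi>. \<lbrakk>\<And>x. (\<phi> has_derivative (\<lambda>h. D\<phi> x \<bullet> h)) (at x); continuous_on UNIV D\<phi>;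
        compact (closure {x. \<phi> x \<noteq> 0})\<rbrakk>
        \<Longrightarrow> (\<integral>x. A (Du x) \<bullet> D\<phi> x \<partial>lborel) = (\<integral>x. F x * \<phi> x \<partial>lborel)"
    and X: "open X" "compact K" "K \<subseteq> X" and Y: "open Y" "compact L" "L \<subseteq> Y"
    and wx: "\<And>x y. \<lbrakk>x \<in> X; y \<in> Y\<rbrakk> \<Longrightarrow> ((\<lambda>x. w x y) has_derivative (\<lambda>h. (Du x - P x y) \<bullet> h)) (at x)"
    and wy: "\<And>x y. \<lbrakk>x \<in> X; y \<in> Y\<rbrakk> \<Longrightarrow> (w x has_derivative (\<lambda>h. (Q x y - Du y) \<bullet> h)) (at y)"
    and supp: "\<And>x y. w x y > 0 \<Longrightarrow> x \<in> K \<and> y \<in> L"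
    and w0: "w x0 y0 > 0"
    and cw: "continuous_on (X \<times> Y) (\<lambda>z. w (fst z) (snd z))"
    and cP: "continuous_on (X \<times> Y) (\<lambda>z. P (fst z) (snd z))"
    and cQ: "continuous_on (X \<times> Y) (\<lambda>z. Q (fst z) (snd z))"
    and AP: "\<And>x y. \<lbrakk>x \<in> X; y \<in> Y\<rbrakk> \<Longrightarrow> ((\<lambda>x. A (P x y)) has_derivative AP x y) (at x)"
    and QX: "\<And>x y. \<lbrakk>x \<in> X; y \<in> Y\<rbrakk> \<Longrightarrow> ((\<lambda>x. Q x y) has_derivative QX x y) (at x)"
    and AQ: "\<And>x y. \<lbrakk>x \<in> X; y \<in> Y\<rbrakk> \<Longrightarrow> ((\<lambda>y. A (Q x y)) has_derivative AQ x y) (at y)"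
    and cAP: "\<And>b. continuous_on (X \<times> Y) (\<lambda>z. AP (fst z) (snd z) b)"
    and cQX: "\<And>b. continuous_on (X \<times> Y) (\<lambda>z. QX (fst z) (snd z) b)"
    and cAQ: "\<And>b. continuous_on (X \<times> Y) (\<lambda>z. AQ (fst z) (snd z) b)"
    and B: "bounded_linear B"
    and pos: "\<And>x y. \<lbrakk>x \<in> X; y \<in> Y\<rbrakk> \<Longrightarrow>
        (A (Du x) - A (P x y)) \<bullet> (Du x - P x y) + 2 * (B (Q x y - Du y) \<bullet> (Du x - P x y))
        + (A (Q x y) - A (Du y)) \<bullet> (Q x y - Du y) \<ge> 0"
    and neg: "\<And>x y. \<lbrakk>x \<in> X; y \<in> Y\<rbrakk> \<Longrightarrow>
        F x - F y + (\<Sum>b\<in>Basis. AP x y b \<bullet> b) - 2 * (\<Sum>b\<in>Basis. B (QX x y b) \<bullet> b)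
        - (\<Sum>b\<in>Basis. AQ x y b \<bullet> b) < 0"
  shows False
proof -
  define \<phi> where "\<phi> x y = (max 0 (w x y))\<^sup>2" for x y
  define Dx where "Dx x y = (2 * max 0 (w x y)) *\<^sub>R (Du x - P x y)" for x y
  define Dy where "Dy x y = (2 * max 0 (w x y)) *\<^sub>R (Q x y - Du y)" for x y
  have max0: "max 0 (w x y) = 0" if "x \<notin> K \<or> y \<notin> L" for x y
    using supp[of x y] that by (cases "w x y > 0") auto
  have zero: "\<phi> x y = 0" "Dx x y = 0" "Dy x y = 0" if "x \<notin> K \<or> y \<notin> L" for x y
    using max0[OF that] by (simp_all add: \<phi>_def Dx_def Dy_def)
  have slice1: "continuous_on S (\<lambda>x. h x y)"
    if "continuous_on (X \<times> Y) (\<lambda>z. h (fst z) (snd z))" "S \<subseteq> X" "y \<in> Y"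
    for h :: "'a \<Rightarrow> 'a \<Rightarrow> 'b::topological_space" and y S
    by (rule continuous_on_compose2[OF that(1), of S "\<lambda>x. (x, y)", simplified])
      (use that(2,3) in \<open>auto intro!: continuous_intros\<close>)
  have slice2: "continuous_on S (\<lambda>y. h x y)"
    if "continuous_on (X \<times> Y) (\<lambda>z. h (fst z) (snd z))" "S \<subseteq> Y" "x \<in> X"
    for h :: "'a \<Rightarrow> 'a \<Rightarrow> 'b::topological_space" and x S
    by (rule continuous_on_compose2[OF that(1), of S "\<lambda>y. (x, y)", simplified])
      (use that(2,3) in \<open>auto intro!: continuous_intros\<close>)
  have cu1: "continuous_on S (\<lambda>z. Du (fst z))" and cu2: "continuous_on S (\<lambda>z. Du (snd z))"
    and cF1: "continuous_on S (\<lambda>z. F (fst z))" and cF2: "continuous_on S (\<lambda>z. F (snd z))"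
    for S :: "('a \<times> 'a) set"
    by (rule continuous_on_compose2[OF cDu] continuous_on_compose2[OF cF],
        auto intro!: continuous_intros)+
  have cAc: "continuous_on S (\<lambda>z. A (h z))" if "continuous_on S h"
    for h :: "'b::topological_space \<Rightarrow> 'a" and S
    using continuous_on_compose2[OF cA that] by auto
  have cB: "continuous_on S (\<lambda>z. B (h z))" if "continuous_on S h"
    for h :: "'b::topological_space \<Rightarrow> 'a" and S
    using bounded_linear.continuous_on[OF B that] .
  have cphi: "continuous_on (X \<times> Y) (\<lambda>z. \<phi> (fst z) (snd z))"
    unfolding \<phi>_def by (intro continuous_intros cw)
  have cDx: "continuous_on (X \<times> Y) (\<lambda>z. Dx (fst z) (snd z))"
    unfolding Dx_def by (intro continuous_intros cw cP cu1)
  have cDy: "continuous_on (X \<times> Y) (\<lambda>z. Dy (fst z) (snd z))"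
    unfolding Dy_def by (intro continuous_intros cw cQ cu2)
  \<comment> \<open>Flux sides \<open>L1\<close>, \<open>L2\<close> and source sides
    \<open>R1\<close>, \<open>R2\<close> of the equations in x and in y. The whole coupling is
    placed in the x-equation. Then \<open>L1 + L2\<close> is \<open>2 * max 0 (w x y)\<close> times
    the form in \<open>pos\<close>, and \<open>R1 + R2\<close> is \<open>\<phi>\<close> times the
    expression in \<open>neg\<close>.\<close>
  define L1 where "L1 x y = (A (Du x) - A (P x y) + 2 *\<^sub>R B (Q x y - Du y)) \<bullet> Dx x y" for x y
  define L2 where "L2 x y = (A (Q x y) - A (Du y)) \<bullet> Dy x y" for x y
  define R1 where "R1 x y = (F x + (\<Sum>b\<in>Basis. AP x y b \<bullet> b) - 2 * (\<Sum>b\<in>Basis. B (QX x y b) \<bullet> b)) * \<phi> x y" for x y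
  define R2 where "R2 x y = (- F y - (\<Sum>b\<in>Basis. AQ x y b \<bullet> b)) * \<phi> x y" for x y
  have cL1: "continuous_on (X \<times> Y) (\<lambda>z. L1 (fst z) (snd z))"
    unfolding L1_def by (intro continuous_intros cAc cB cP cQ cDx cu1 cu2)
  have cL2: "continuous_on (X \<times> Y) (\<lambda>z. L2 (fst z) (snd z))"
    unfolding L2_def by (intro continuous_intros cAc cB cP cQ cDy cu1 cu2)
  have cR1: "continuous_on (X \<times> Y) (\<lambda>z. R1 (fst z) (snd z))"
    unfolding R1_def by (intro continuous_intros cB cAP cQX cphi cF1)
  have cR2: "continuous_on (X \<times> Y) (\<lambda>z. R2 (fst z) (snd z))"
    unfolding R2_def by (intro continuous_intros cAQ cphi cF2)
  have int: "integrable lborel (\<lambda>z. h (fst z) (snd z))"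
    if "continuous_on (X \<times> Y) (\<lambda>z. h (fst z) (snd z))" "\<And>x y. x \<notin> K \<or> y \<notin> L \<Longrightarrow> h x y = 0"
    for h :: "'a \<Rightarrow> 'a \<Rightarrow> real"
  proof (rule integrable_compact_support[of "K \<times> L"])
    show "continuous_on (K \<times> L) (\<lambda>z. h (fst z) (snd z))"
      using X Y by (intro continuous_on_subset[OF that(1)]) auto
    show "h (fst z) (snd z) = 0" if "z \<notin> K \<times> L" for z
      using \<open>\<And>x y. x \<notin> K \<or> y \<notin> L \<Longrightarrow> h x y = 0\<close>[of "fst z" "snd z"] that
      by (auto simp: mem_Times_iff)
  qed (use X Y in \<open>auto intro: compact_Times\<close>)
  have iL1: "integrable lborel (\<lambda>z. L1 (fst z) (snd z))" and iL2: "integrable lborel (\<lambda>z. L2 (fst z) (snd z))"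
    and iR1: "integrable lborel (\<lambda>z. R1 (fst z) (snd z))" and iR2: "integrable lborel (\<lambda>z. R2 (fst z) (snd z))"
    by (intro int cL1 cL2 cR1 cR2; simp add: L1_def L2_def R1_def R2_def zero)+
  have int1: "integrable lborel (\<lambda>x. h x y)"
    if "continuous_on (X \<times> Y) (\<lambda>z. h (fst z) (snd z))" "\<And>x y. x \<notin> K \<or> y \<notin> L \<Longrightarrow> h x y = 0" "y \<in> Y"
    for h :: "'a \<Rightarrow> 'a \<Rightarrow> real" and y
    using X that by (intro integrable_compact_support[of K] slice1) auto
  have int2: "integrable lborel (\<lambda>y. h x y)"
    if "continuous_on (X \<times> Y) (\<lambda>z. h (fst z) (snd z))" "\<And>x y. x \<notin> K \<or> y \<notin> L \<Longrightarrow> h x y = 0" "x \<in> X"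
    for h :: "'a \<Rightarrow> 'a \<Rightarrow> real" and x
    using Y that by (intro integrable_compact_support[of L] slice2) auto
  have derx: "((\<lambda>x. \<phi> x y) has_derivative (\<lambda>h. Dx x y \<bullet> h)) (at x)" if "y \<in> L" for x y
  proof (cases "x \<in> K")
    case True
    have "((\<lambda>x. w x y) has_derivative (\<lambda>h. (Du x - P x y) \<bullet> h)) (at x)"
      using wx True that X Y by blast
    from has_derivative_square_positive_part[OF this] show ?thesis
      by (simp add: \<phi>_def Dx_def)
  next
    case False
    then show ?thesis
      using has_derivative_zero_outside[of K "\<lambda>x. \<phi> x y" x] X(2) zero by (simp add: compact_imp_closed)
  qed
  have dery: "((\<lambda>y. \<phi> x y) has_derivative (\<lambda>h. Dy x y \<bullet> h)) (at y)" if "x \<in> K" for x y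
  proof (cases "y \<in> L")
    case True
    have "(w x has_derivative (\<lambda>h. (Q x y - Du y) \<bullet> h)) (at y)"
      using wy True that X Y by blast
    from has_derivative_square_positive_part[OF this] show ?thesis
      by (simp add: \<phi>_def Dy_def)
  next
    case False
    then show ?thesis
      using has_derivative_zero_outside[of L "\<lambda>y. \<phi> x y" y] Y(2) zero by (simp add: compact_imp_closed)
  qed
  have csupp: "compact (closure {x. h x \<noteq> 0})" if "compact M" "\<And>x. x \<notin> M \<Longrightarrow> h x = 0"
    for M and h :: "'a \<Rightarrow> real"
    using that bounded_subset[OF compact_imp_bounded[OF that(1)], of "{x. h x \<noteq> 0}"]
    by (auto simp: compact_closure)
  have eq1: "(\<integral>x. L1 x y \<partial>lborel) = (\<integral>x. R1 x y \<partial>lborel)" for y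
  proof (cases "y \<in> L")
    case False
    then show ?thesis by (simp add: L1_def R1_def zero)
  next
    case True
    then have y: "y \<in> Y" using Y by auto
    \<comment> \<open>With y frozen, \<open>B (Du y)\<close> is constant in x and drops out of
      \<open>V'\<close>. Thus a term containing the merely continuous \<open>Du y\<close> can be
      integrated by parts.\<close>
    define V where "V x = A (P x y) - 2 *\<^sub>R B (Q x y - Du y)" for x
    define V' where "V' x h = AP x y h - 2 *\<^sub>R B (QX x y h)" for x h
    have cD: "continuous_on UNIV (\<lambda>x. Dx x y)"
      by (rule continuous_on_zero_outside[OF X(1) compact_imp_closed[OF X(2)] X(3)])
        (auto simp: zero intro!: slice1[OF cDx] y)
    have "(\<integral>x. A (Du x) \<bullet> Dx x y \<partial>lborel) = (\<integral>x. F x * \<phi> x y \<partial>lborel)"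
      by (rule weak[OF derx[OF True] cD csupp[OF X(2)]]) (simp add: zero)
    moreover have "(\<integral>x. V x \<bullet> Dx x y \<partial>lborel) = - (\<integral>x. (\<Sum>b\<in>Basis. V' x b \<bullet> b) * \<phi> x y \<partial>lborel)"
    proof (rule integral_inner_gradient_compact_support[OF _ _ X(1,3) derx[OF True] cD X(2)])
      show "(V has_derivative V' x) (at x)" if "x \<in> X" for x
      proof -
        have "((\<lambda>x. B (Q x y - Du y)) has_derivative (\<lambda>h. B (QX x y h - 0))) (at x)"
          by (intro bounded_linear.has_derivative[OF B] has_derivative_diff QX that y has_derivative_const)
        then have "((\<lambda>x. B (Q x y - Du y)) has_derivative (\<lambda>h. B (QX x y h))) (at x)" by simp
        then show ?thesis
          unfolding V_def V'_def
          by (intro has_derivative_diff has_derivative_scaleR_right AP that y)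
      qed
      show "continuous_on X (\<lambda>x. V' x b)" for b
        unfolding V'_def by (intro continuous_intros cB slice1[OF cAP] slice1[OF cQX] y order_refl)
    qed (simp add: zero)
    moreover have "(\<integral>x. A (Du x) \<bullet> Dx x y - V x \<bullet> Dx x y \<partial>lborel)
        = (\<integral>x. A (Du x) \<bullet> Dx x y \<partial>lborel) - (\<integral>x. V x \<bullet> Dx x y \<partial>lborel)"
      unfolding V_def
      by (intro Bochner_Integration.integral_diff int1[of "\<lambda>x y. A (Du x) \<bullet> Dx x y", OF _ _ y]
          int1[of "\<lambda>x y. (A (P x y) - 2 *\<^sub>R B (Q x y - Du y)) \<bullet> Dx x y", OF _ _ y]
          continuous_intros cAc cB cP cQ cDx cu1 cu2) (simp_all add: zero)
    moreover have "(\<integral>x. F x * \<phi> x y + (\<Sum>b\<in>Basis. V' x b \<bullet> b) * \<phi> x y \<partial>lborel)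
        = (\<integral>x. F x * \<phi> x y \<partial>lborel) + (\<integral>x. (\<Sum>b\<in>Basis. V' x b \<bullet> b) * \<phi> x y \<partial>lborel)"
      unfolding V'_def
      by (intro Bochner_Integration.integral_add int1[of "\<lambda>x y. F x * \<phi> x y", OF _ _ y]
          int1[of "\<lambda>x y. (\<Sum>b\<in>Basis. (AP x y b - 2 *\<^sub>R B (QX x y b)) \<bullet> b) * \<phi> x y", OF _ _ y]
          continuous_intros cB cAP cQX cphi cF1) (simp_all add: zero)
    moreover have "L1 x y = A (Du x) \<bullet> Dx x y - V x \<bullet> Dx x y" for x
      by (simp add: L1_def V_def inner_diff_left inner_add_left)
    moreover have "R1 x y = F x * \<phi> x y + (\<Sum>b\<in>Basis. V' x b \<bullet> b) * \<phi> x y" for x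
      by (simp add: R1_def V'_def inner_diff_left sum_subtractf sum_distrib_left algebra_simps)
    ultimately show ?thesis by simp
  qed
  have eq2: "(\<integral>y. L2 x y \<partial>lborel) = (\<integral>y. R2 x y \<partial>lborel)" for x
  proof (cases "x \<in> K")
    case False
    then show ?thesis by (simp add: L2_def R2_def zero)
  next
    case True
    then have x: "x \<in> X" using X by auto
    have cD: "continuous_on UNIV (\<lambda>y. Dy x y)"
      by (rule continuous_on_zero_outside[OF Y(1) compact_imp_closed[OF Y(2)] Y(3)])
        (auto simp: zero intro!: slice2[OF cDy] x)
    have "(\<integral>y. A (Du y) \<bullet> Dy x y \<partial>lborel) = (\<integral>y. F y * \<phi> x y \<partial>lborel)"
      by (rule weak[OF dery[OF True] cD csupp[OF Y(2)]]) (simp add: zero)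
    moreover have "(\<integral>y. A (Q x y) \<bullet> Dy x y \<partial>lborel) = - (\<integral>y. (\<Sum>b\<in>Basis. AQ x y b \<bullet> b) * \<phi> x y \<partial>lborel)"
      by (rule integral_inner_gradient_compact_support[OF AQ[OF x] _ Y(1,3) dery[OF True] cD Y(2)])
        (auto simp: zero intro!: slice2[OF cAQ] x)
    moreover have "(\<integral>y. A (Q x y) \<bullet> Dy x y - A (Du y) \<bullet> Dy x y \<partial>lborel)
        = (\<integral>y. A (Q x y) \<bullet> Dy x y \<partial>lborel) - (\<integral>y. A (Du y) \<bullet> Dy x y \<partial>lborel)"
      by (intro Bochner_Integration.integral_diff int2[of "\<lambda>x y. A (Q x y) \<bullet> Dy x y", OF _ _ x]
          int2[of "\<lambda>x y. A (Du y) \<bullet> Dy x y", OF _ _ x]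
          continuous_intros cAc cQ cDy cu2) (simp_all add: zero)
    moreover have "(\<integral>y. - (F y * \<phi> x y) - (\<Sum>b\<in>Basis. AQ x y b \<bullet> b) * \<phi> x y \<partial>lborel)
        = (\<integral>y. - (F y * \<phi> x y) \<partial>lborel) - (\<integral>y. (\<Sum>b\<in>Basis. AQ x y b \<bullet> b) * \<phi> x y \<partial>lborel)"
      by (intro Bochner_Integration.integral_diff int2[of "\<lambda>x y. - (F y * \<phi> x y)", OF _ _ x]
          int2[of "\<lambda>x y. (\<Sum>b\<in>Basis. AQ x y b \<bullet> b) * \<phi> x y", OF _ _ x]
          continuous_intros cAQ cphi cF2) (simp_all add: zero)
    moreover have "L2 x y = A (Q x y) \<bullet> Dy x y - A (Du y) \<bullet> Dy x y" for y
      by (simp add: L2_def inner_diff_left)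
    moreover have "R2 x y = - (F y * \<phi> x y) - (\<Sum>b\<in>Basis. AQ x y b \<bullet> b) * \<phi> x y" for y
      by (simp add: R2_def algebra_simps)
    ultimately show ?thesis by simp
  qed
  \<comment> \<open>Integrating \<open>eq1\<close> over y and \<open>eq2\<close> over x gives one
    identity on the product space. Its left side is nonnegative by \<open>pos\<close>; its right
    side is negative by \<open>neg\<close>, strictly so because \<open>w\<close> is positive on an
    open set around \<open>(x0, y0)\<close>.\<close>
  have "(\<integral>z. L1 (fst z) (snd z) + L2 (fst z) (snd z) \<partial>lborel)
      = (\<integral>z. R1 (fst z) (snd z) + R2 (fst z) (snd z) \<partial>lborel)"
    using iterated_integrals_agree(1)[OF iL1] iterated_integrals_agree(2)[OF iL2]
      iterated_integrals_agree(1)[OF iR1] iterated_integrals_agree(2)[OF iR2]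
    by (simp add: eq1 eq2 iL1 iL2 iR1 iR2)
  moreover have "(\<integral>z. L1 (fst z) (snd z) + L2 (fst z) (snd z) \<partial>lborel) \<ge> 0"
  proof (intro integral_nonneg_AE AE_I2)
    fix z :: "'a \<times> 'a"
    show "0 \<le> L1 (fst z) (snd z) + L2 (fst z) (snd z)"
    proof (cases "fst z \<in> K \<and> snd z \<in> L")
      case True
      define x where "x = fst z"
      define y where "y = snd z"
      have "0 \<le> 2 * max 0 (w x y) * ((A (Du x) - A (P x y)) \<bullet> (Du x - P x y) + 2 * (B (Q x y - Du y) \<bullet> (Du x - P x y))
        + (A (Q x y) - A (Du y)) \<bullet> (Q x y - Du y))"
        using pos[of x y] True X Y by (intro mult_nonneg_nonneg) (auto simp: x_def y_def)
      also have "\<dots> = L1 x y + L2 x y"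
        by (simp add: L1_def L2_def Dx_def Dy_def inner_add_left algebra_simps)
      finally show ?thesis by (simp add: x_def y_def)
    qed (auto simp: L1_def L2_def zero)
  qed
  moreover have "(\<integral>z. R1 (fst z) (snd z) + R2 (fst z) (snd z) \<partial>lborel) < 0"
  proof (rule integral_nonpos_neg_on_open)
    show "integrable lborel (\<lambda>z. R1 (fst z) (snd z) + R2 (fst z) (snd z))"
      using iR1 iR2 by simp
    have R: "R1 x y + R2 x y = (F x - F y + (\<Sum>b\<in>Basis. AP x y b \<bullet> b) - 2 * (\<Sum>b\<in>Basis. B (QX x y b) \<bullet> b)
        - (\<Sum>b\<in>Basis. AQ x y b \<bullet> b)) * \<phi> x y" for x y
      unfolding R1_def R2_def by (simp add: algebra_simps)
    show "R1 (fst z) (snd z) + R2 (fst z) (snd z) \<le> 0" for z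
    proof (cases "fst z \<in> K \<and> snd z \<in> L")
      case True
      then have "fst z \<in> X" "snd z \<in> Y" using X Y by auto
      then show ?thesis unfolding R
        using less_imp_le[OF neg] by (intro mult_nonpos_nonneg) (auto simp: \<phi>_def)
    qed (auto simp: R1_def R2_def zero)
    let ?S = "(X \<times> Y) \<inter> (\<lambda>z. w (fst z) (snd z)) -` {0<..}"
    show "open ?S"
      using continuous_on_open_vimage[OF open_Times[OF X(1) Y(1)], of "\<lambda>z. w (fst z) (snd z)"] cw
      by (simp add: Int_commute)
    have "(x0, y0) \<in> ?S" using w0 supp[OF w0] X Y by auto
    then show "?S \<noteq> {}" by blast
    show "R1 (fst z) (snd z) + R2 (fst z) (snd z) < 0" if "z \<in> ?S" for z
      unfolding R using neg[of "fst z" "snd z"] that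
      by (intro mult_neg_pos) (auto simp: \<phi>_def max_def mem_Times_iff)
  qed
  ultimately show False by simp
qed

section \<open>The fields of power type\<close>

text \<open>For exponents \<open>p\<close> and \<open>q\<close> this is the flux of the
  corresponding Laplacian; for exponent \<alpha> it is, up to the factor \<alpha>, the gradient of
  the penalty \<open>norm z powr \<alpha>\<close>.\<close>

definition power_field :: "real \<Rightarrow> 'a::real_inner \<Rightarrow> 'a" where
  "power_field s v = norm v powr (s - 2) *\<^sub>R v"

text \<open>The Jacobian of \<open>power_field s\<close> at a nonzero \<xi>: eigenvalue
  \<open>(s - 1) * norm \<xi> powr (s - 2)\<close> along \<xi> and
  \<open>norm \<xi> powr (s - 2)\<close> orthogonally to it.\<close>

definition power_field_deriv :: "real \<Rightarrow> 'a::real_inner \<Rightarrow> 'a \<Rightarrow> 'a" where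
  "power_field_deriv s \<xi> v = norm \<xi> powr (s - 2) *\<^sub>R (v + ((s - 2) * (sgn \<xi> \<bullet> v)) *\<^sub>R sgn \<xi>)"

lemma norm_power_field: "norm (power_field s v) = norm v powr (s - 1)"
proof (cases "v = 0")
  case False
  then have "norm v powr (s - 2) * norm v = norm v powr (s - 2) * norm v powr 1" by simp
  also have "\<dots> = norm v powr (s - 1)" by (subst powr_add[symmetric]) simp
  finally show ?thesis by (simp add: power_field_def)
qed (simp add: power_field_def)

lemma has_derivative_norm_powr:
  fixes \<xi> :: "'a::real_inner"
  assumes "\<xi> \<noteq> 0"
  shows "((\<lambda>z. norm z powr a) has_derivative (\<lambda>h. a * norm \<xi> powr (a - 1) * (sgn \<xi> \<bullet> h))) (at \<xi>)"
proof -
  have "((\<lambda>t. t powr a) has_derivative (*) (a * norm \<xi> powr (a - 1))) (at (norm \<xi>))"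
    using has_real_derivative_powr[of "norm \<xi>" a] assms by (simp add: has_field_derivative_def)
  from has_derivative_compose[OF has_derivative_norm[OF assms] this]
  show ?thesis by (simp add: inner_commute)
qed

lemma has_derivative_norm_powr_power_field:
  fixes \<xi> :: "'a::real_inner"
  assumes "\<xi> \<noteq> 0"
  shows "((\<lambda>z. norm z powr a) has_derivative (\<lambda>h. a * (power_field a \<xi> \<bullet> h))) (at \<xi>)"
proof -
  have "norm \<xi> powr (a - 1) = norm \<xi> powr (a - 2) * norm \<xi>"
    using powr_add[of "norm \<xi>" "a - 2" 1] assms by simp
  then have "norm \<xi> powr (a - 1) * (sgn \<xi> \<bullet> h) = power_field a \<xi> \<bullet> h" for h
    using assms by (simp add: power_field_def sgn_div_norm)
  then show ?thesis using has_derivative_norm_powr[OF assms, of a] by (simp add: mult.assoc)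
qed

lemma has_derivative_power_field:
  fixes \<xi> :: "'a::real_inner"
  assumes "\<xi> \<noteq> 0"
  shows "(power_field s has_derivative power_field_deriv s \<xi>) (at \<xi>)"
proof -
  have e: "norm \<xi> powr (s - 2 - 1) *\<^sub>R \<xi> = norm \<xi> powr (s - 2) *\<^sub>R sgn \<xi>"
    using powr_add[of "norm \<xi>" "s - 2 - 1" 1] assms by (simp add: sgn_div_norm)
  have "((\<lambda>z. norm z powr (s - 2) *\<^sub>R z) has_derivative
      (\<lambda>h. norm \<xi> powr (s - 2) *\<^sub>R h + ((s - 2) * norm \<xi> powr (s - 2 - 1) * (sgn \<xi> \<bullet> h)) *\<^sub>R \<xi>)) (at \<xi>)"
    by (intro has_derivative_scaleR has_derivative_norm_powr assms has_derivative_ident)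
  moreover have "norm \<xi> powr (s - 2) *\<^sub>R h + ((s - 2) * norm \<xi> powr (s - 2 - 1) * (sgn \<xi> \<bullet> h)) *\<^sub>R \<xi>
      = power_field_deriv s \<xi> h" for h
  proof -
    have "((s - 2) * norm \<xi> powr (s - 2 - 1) * (sgn \<xi> \<bullet> h)) *\<^sub>R \<xi>
        = ((s - 2) * (sgn \<xi> \<bullet> h)) *\<^sub>R (norm \<xi> powr (s - 2 - 1) *\<^sub>R \<xi>)"
      by (simp add: mult.assoc mult.left_commute mult.commute)
    then show ?thesis
      unfolding e by (simp add: power_field_deriv_def scaleR_add_right mult.commute)
  qed
  ultimately show ?thesis by (simp add: power_field_def[abs_def])
qed

text \<open>Differentiability covers nonzero points. At 0 the norm of the field is
  \<open>norm v powr (s - 1)\<close>, which tends to 0 because \<open>s > 1\<close>.\<close>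

lemma continuous_on_power_field:
  fixes S :: "'a::real_inner set"
  assumes "s > 1"
  shows "continuous_on S (power_field s)"
proof -
  have "isCont (power_field s) \<xi>" for \<xi> :: 'a
  proof (cases "\<xi> = 0")
    case True
    have "((\<lambda>v::'a. norm v powr (s - 1)) \<longlongrightarrow> 0 powr (s - 1)) (at 0)"
      by (rule tendsto_powr') (use assms in \<open>auto intro!: tendsto_norm_zero\<close>)
    then have "((\<lambda>v::'a. norm (power_field s v)) \<longlongrightarrow> 0) (at 0)"
      by (simp add: norm_power_field)
    moreover have "power_field s (0::'a) = 0"
      by (simp add: power_field_def)
    ultimately show ?thesis
      using True by (simp add: isCont_def tendsto_norm_zero_iff)
  next
    case False
    then show ?thesis using has_derivative_power_field has_derivative_continuous by blast
  qed
  then show ?thesis by (simp add: continuous_at_imp_continuous_on)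
qed

lemma continuous_on_power_field_deriv:
  assumes "continuous_on S h" "continuous_on S k" "\<And>x. x \<in> S \<Longrightarrow> h x \<noteq> 0"
  shows "continuous_on S (\<lambda>x. power_field_deriv s (h x) (k x))"
  unfolding power_field_deriv_def sgn_div_norm
  using assms by (intro continuous_intros) auto

lemma power_field_deriv_scaled_unit:
  assumes "norm e = 1" "w > 0"
  shows "power_field_deriv s (w *\<^sub>R e) v = w powr (s - 2) *\<^sub>R (v + ((s - 2) * (e \<bullet> v)) *\<^sub>R e)"
  using assms by (simp add: power_field_deriv_def sgn_div_norm)

text \<open>The Jacobian is homogeneous of degree \<open>s - 2\<close>, so after division by
  \<open>w\<close> the claim is continuity at unit vectors, and \<tau> depends on neither
  \<open>w\<close> nor \<open>e\<close>. It permits freezing the Jacobian at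
  \<open>w *\<^sub>R e\<close> on a ball whose radius is proportional to \<open>w\<close>.\<close>

lemma power_field_deriv_uniform_cone:
  assumes "\<delta> > 0"
  obtains \<tau> where "0 < \<tau>" "\<tau> < 1"
    "\<And>w (e::'a::real_inner) \<xi> v. \<lbrakk>w > 0; norm e = 1; norm (\<xi> - w *\<^sub>R e) \<le> \<tau> * w\<rbrakk>
      \<Longrightarrow> norm (power_field_deriv s \<xi> v - power_field_deriv s (w *\<^sub>R e) v) \<le> \<delta> * w powr (s - 2) * norm v"
proof -
  \<comment> \<open>\<open>D\<close> bounds the operator norm of
    \<open>v + ((s - 2) * (e \<bullet> v)) *\<^sub>R e\<close> for unit \<open>e\<close>.\<close>
  define D where "D = 1 + \<bar>s - 2\<bar>"
  have D: "D \<ge> 1" "\<bar>s - 2\<bar> \<le> D" by (auto simp: D_def)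
  have "((\<lambda>t. t powr (s - 2)) \<longlongrightarrow> 1 powr (s - 2)) (at (1::real))"
    by (intro tendsto_intros) auto
  moreover have "min 1 (\<delta> / (2 * D)) > 0" using assms D by simp
  ultimately have "\<forall>\<^sub>F t in at (1::real). dist (t powr (s - 2)) (1 powr (s - 2)) < min 1 (\<delta> / (2 * D))"
    by (rule tendstoD)
  then obtain \<eta> where \<eta>: "\<eta> > 0"
    "\<And>t. t \<noteq> 1 \<Longrightarrow> \<bar>t - 1\<bar> < \<eta> \<Longrightarrow> \<bar>t powr (s - 2) - 1\<bar> < min 1 (\<delta> / (2 * D))"
    by (auto simp only: eventually_at dist_real_def powr_one_eq_one UNIV_I simp_thms)
  \<comment> \<open>The bound 1/2 keeps \<xi> away from 0, \<eta>/2 keeps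
    \<open>norm \<xi> / w\<close> where its power is near 1, and the last bound makes the error from
    turning the direction at most \<delta>/4.\<close>
  define \<tau> where "\<tau> = min (1/2) (min (\<eta>/2) (\<delta> / (16 * D)))"
  have "\<tau> > 0" "\<tau> \<le> 1/2" "\<tau> \<le> \<eta>/2" "\<tau> \<le> \<delta> / (16 * D)"
    using assms D \<eta>(1) by (auto simp: \<tau>_def)
  then have \<tau>: "\<tau> > 0" "\<tau> < 1" "\<tau> < \<eta>" "16 * D * \<tau> \<le> \<delta>"
    using D \<eta>(1) by (auto simp: field_simps)
  show thesis
  proof (rule that[OF \<tau>(1,2)])
    fix w :: real and e \<xi> v :: 'a
    assume w: "w > 0" and e: "norm e = 1" and \<xi>: "norm (\<xi> - w *\<^sub>R e) \<le> \<tau> * w"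
    define t where "t = norm \<xi> / w"
    have "\<bar>norm \<xi> - w\<bar> \<le> \<tau> * w"
      using norm_triangle_ineq3[of \<xi> "w *\<^sub>R e"] \<xi> w e by simp
    then have t: "\<bar>t - 1\<bar> \<le> \<tau>"
      using w by (simp add: t_def abs_le_iff field_simps)
    then have tp: "t > 0" using \<tau> by linarith
    then have \<xi>0: "norm \<xi> > 0" using w by (simp add: t_def zero_less_divide_iff)
    have pw: "norm \<xi> powr (s - 2) = t powr (s - 2) * w powr (s - 2)"
      using w \<xi>0 by (simp add: t_def flip: powr_mult)
    have tt: "\<bar>t powr (s - 2) - 1\<bar> \<le> min 1 (\<delta> / (2 * D))"
      using \<eta>(2)[of t] t \<tau>(3) \<open>min 1 (\<delta> / (2 * D)) > 0\<close> by (cases "t = 1") auto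
    have sg: "norm (sgn \<xi> - e) \<le> 2 * \<tau>"
    proof -
      have "sgn \<xi> - e = (1 - t) *\<^sub>R sgn \<xi> + (1 / w) *\<^sub>R (\<xi> - w *\<^sub>R e)"
        using w \<xi>0 by (simp add: t_def sgn_div_norm algebra_simps)
      also have "norm \<dots> \<le> \<bar>1 - t\<bar> * 1 + (1 / w) * (\<tau> * w)"
        using \<xi> w \<xi>0 by (intro norm_triangle_le add_mono) (auto simp: norm_sgn pos_divide_le_eq)
      finally show ?thesis using t w by simp
    qed
    define a where "a = v + ((s - 2) * (sgn \<xi> \<bullet> v)) *\<^sub>R sgn \<xi>"
    define b where "b = v + ((s - 2) * (e \<bullet> v)) *\<^sub>R e"
    have "norm b \<le> norm v + \<bar>s - 2\<bar> * norm v"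
      unfolding b_def
      by (rule norm_triangle_le) (use Cauchy_Schwarz_ineq2[of e v] e in \<open>auto simp: abs_mult intro!: mult_left_mono\<close>)
    then have nb: "norm b \<le> D * norm v" by (simp add: D_def algebra_simps)
    have "a - b = ((s - 2) * (sgn \<xi> \<bullet> v)) *\<^sub>R (sgn \<xi> - e) + ((s - 2) * ((sgn \<xi> - e) \<bullet> v)) *\<^sub>R e"
      by (simp add: a_def b_def algebra_simps inner_diff_left)
    also have "norm \<dots> \<le> \<bar>s - 2\<bar> * norm v * (2 * \<tau>) + \<bar>s - 2\<bar> * (2 * \<tau> * norm v)"
    proof (rule norm_triangle_le[OF add_mono])
      have "\<bar>sgn \<xi> \<bullet> v\<bar> \<le> norm v"
        using Cauchy_Schwarz_ineq2[of "sgn \<xi>" v] \<xi>0 by (simp add: norm_sgn)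
      then show "norm (((s - 2) * (sgn \<xi> \<bullet> v)) *\<^sub>R (sgn \<xi> - e)) \<le> \<bar>s - 2\<bar> * norm v * (2 * \<tau>)"
        using sg by (auto simp: abs_mult intro!: mult_mono)
      have "\<bar>(sgn \<xi> - e) \<bullet> v\<bar> \<le> 2 * \<tau> * norm v"
        using Cauchy_Schwarz_ineq2[of "sgn \<xi> - e" v] sg by (meson mult_right_mono norm_ge_zero order_trans)
      then show "norm (((s - 2) * ((sgn \<xi> - e) \<bullet> v)) *\<^sub>R e) \<le> \<bar>s - 2\<bar> * (2 * \<tau> * norm v)"
        using e by (auto simp: abs_mult intro!: mult_left_mono)
    qed
    also have "\<dots> = (4 * \<bar>s - 2\<bar> * \<tau>) * norm v" by (simp add: algebra_simps)
    also have "\<dots> \<le> (\<delta> / 4) * norm v"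
    proof (rule mult_right_mono)
      have "4 * \<bar>s - 2\<bar> * \<tau> \<le> 4 * D * \<tau>" using D \<tau> by simp
      then show "4 * \<bar>s - 2\<bar> * \<tau> \<le> \<delta> / 4" using \<tau>(4) by simp
    qed simp
    finally have ab: "norm (a - b) \<le> (\<delta> / 4) * norm v" .
    \<comment> \<open>The error splits into a change of direction, amplified by at most 2, and a
      change of length; each contributes at most half of \<delta>.\<close>
    have "norm (t powr (s - 2) *\<^sub>R a - b) = norm (t powr (s - 2) *\<^sub>R (a - b) + (t powr (s - 2) - 1) *\<^sub>R b)"
      by (simp add: algebra_simps)
    also have "\<dots> \<le> 2 * ((\<delta> / 4) * norm v) + \<delta> / (2 * D) * (D * norm v)"
    proof (intro norm_triangle_le add_mono)
      have "\<bar>t powr (s - 2)\<bar> * norm (a - b) \<le> 2 * ((\<delta> / 4) * norm v)"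
        using tt ab by (intro mult_mono) auto
      then show "norm (t powr (s - 2) *\<^sub>R (a - b)) \<le> 2 * ((\<delta> / 4) * norm v)" by simp
      have "\<bar>t powr (s - 2) - 1\<bar> * norm b \<le> \<delta> / (2 * D) * (D * norm v)"
        using tt nb D assms by (intro mult_mono) auto
      then show "norm ((t powr (s - 2) - 1) *\<^sub>R b) \<le> \<delta> / (2 * D) * (D * norm v)" by simp
    qed
    also have "\<dots> = \<delta> * norm v" using D by simp
    finally have "norm (t powr (s - 2) *\<^sub>R a - b) \<le> \<delta> * norm v" .
    then have "w powr (s - 2) * norm (t powr (s - 2) *\<^sub>R a - b) \<le> w powr (s - 2) * (\<delta> * norm v)"
      by (rule mult_left_mono) simp
    moreover have "power_field_deriv s \<xi> v - power_field_deriv s (w *\<^sub>R e) v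
        = w powr (s - 2) *\<^sub>R (t powr (s - 2) *\<^sub>R a - b)"
      unfolding power_field_deriv_scaled_unit[OF e w]
      by (simp add: power_field_deriv_def pw a_def b_def scaleR_diff_right mult.commute)
    ultimately show "norm (power_field_deriv s \<xi> v - power_field_deriv s (w *\<^sub>R e) v) \<le> \<delta> * w powr (s - 2) * norm v"
      by (simp add: mult_ac)
  qed
qed

text \<open>Mean value theorem for \<open>V\<close> paired with \<xi> - \<eta> along the segment,
  which convexity keeps inside \<open>U\<close>. It converts lower bounds on the Jacobian into
  strong monotonicity of the field.\<close>

lemma inner_diff_ge_of_derivative:
  fixes V :: "'a::euclidean_space \<Rightarrow> 'a"
  assumes "convex U" "\<And>\<xi>. \<xi> \<in> U \<Longrightarrow> (V has_derivative V' \<xi>) (at \<xi>)"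
    and "\<xi> \<in> U" "\<eta> \<in> U"
    and "\<And>\<zeta>. \<zeta> \<in> U \<Longrightarrow> c \<le> V' \<zeta> (\<xi> - \<eta>) \<bullet> (\<xi> - \<eta>)"
  shows "c \<le> (V \<xi> - V \<eta>) \<bullet> (\<xi> - \<eta>)"
proof -
  define d where "d = \<xi> - \<eta>"
  have in_U: "\<eta> + t *\<^sub>R d \<in> U" if "0 \<le> t" "t \<le> 1" for t
    using convexD_alt[OF assms(1,4,3) that] by (simp add: d_def algebra_simps)
  have "\<exists>t. t > 0 \<and> t < 1 \<and> V (\<eta> + 1 *\<^sub>R d) \<bullet> d - V (\<eta> + 0 *\<^sub>R d) \<bullet> d = (1 - 0) * (V' (\<eta> + t *\<^sub>R d) d \<bullet> d)"
  proof (rule MVT2[OF zero_less_one, of "\<lambda>t. V (\<eta> + t *\<^sub>R d) \<bullet> d" "\<lambda>t. V' (\<eta> + t *\<^sub>R d) d \<bullet> d"])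
    fix t :: real assume t: "0 \<le> t" "t \<le> 1"
    note V' = assms(2)[OF in_U[OF t]]
    have "((\<lambda>t. V (\<eta> + t *\<^sub>R d) \<bullet> d) has_derivative (\<lambda>y. V' (\<eta> + t *\<^sub>R d) (y *\<^sub>R d) \<bullet> d)) (at t)"
      by (intro has_derivative_inner_left has_derivative_compose[where f = "\<lambda>t. \<eta> + t *\<^sub>R d", OF _ V'])
        (auto intro!: derivative_eq_intros)
    moreover have "V' (\<eta> + t *\<^sub>R d) (y *\<^sub>R d) = y *\<^sub>R V' (\<eta> + t *\<^sub>R d) d" for y
      using linear_scale[OF has_derivative_linear[OF V']] by simp
    ultimately show "((\<lambda>t. V (\<eta> + t *\<^sub>R d) \<bullet> d) has_real_derivative V' (\<eta> + t *\<^sub>R d) d \<bullet> d) (at t)"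
      by (simp add: has_field_derivative_def mult_commute_abs)
  qed
  then obtain t where t: "t > 0" "t < 1" "(V \<xi> - V \<eta>) \<bullet> d = V' (\<eta> + t *\<^sub>R d) d \<bullet> d"
    by (auto simp: d_def inner_diff_left)
  then show ?thesis using assms(5)[OF in_U[of t]] by (simp add: d_def)
qed

section \<open>Reflection coupling\<close>

text \<open>
  With \<open>R\<close> the reflection along \<open>e\<close> and \<open>M v = (S - \<sigma>) v + (T - S) (e \<bullet> v) e\<close>, the coupling matrix is \<open>M R\<close>,
  so that the quadratic form below dominates \<open>M (d + R d') \<bullet> (d + R d')\<close>.
\<close>

lemma reflection_coupling_nonneg:
  fixes e d d' :: "'a::real_inner"
  assumes e: "norm e = 1" and st: "\<sigma> \<le> S" "\<sigma> \<le> T"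
    and m: "(S - \<sigma>) * (d \<bullet> d) + (T - S) * (e \<bullet> d)\<^sup>2 \<le> m"
    and m': "(S - \<sigma>) * (d' \<bullet> d') + (T - S) * (e \<bullet> d')\<^sup>2 \<le> m'"
  shows "0 \<le> m + 2 * (((S - \<sigma>) *\<^sub>R d' - ((S + T - 2 * \<sigma>) * (e \<bullet> d')) *\<^sub>R e) \<bullet> d) + m'"
proof -
  have ee: "e \<bullet> e = 1" using e by (simp add: dot_square_norm)
  define c where "c = d - (e \<bullet> d) *\<^sub>R e"
  define c' where "c' = d' - (e \<bullet> d') *\<^sub>R e"
  \<comment> \<open>This is \<open>M (d + R d') \<bullet> (d + R d')\<close>: the vector has
    orthogonal part \<open>c + c'\<close> and component
    \<open>e \<bullet> d - e \<bullet> d'\<close> along \<open>e\<close>, and \<open>M\<close> has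
    eigenvalues \<open>S - \<sigma>\<close> and \<open>T - \<sigma>\<close> there.\<close>
  have "0 \<le> (S - \<sigma>) * ((c + c') \<bullet> (c + c')) + (T - \<sigma>) * (e \<bullet> d - e \<bullet> d')\<^sup>2"
    using st by (intro add_nonneg_nonneg mult_nonneg_nonneg) auto
  also have "(c + c') \<bullet> (c + c') = d \<bullet> d + 2 * (d \<bullet> d') + d' \<bullet> d' - (e \<bullet> d + e \<bullet> d')\<^sup>2"
    unfolding c_def c'_def
    by (simp add: inner_add_left inner_add_right inner_diff_left inner_diff_right ee
        inner_commute[of d e] inner_commute[of d' e] inner_commute[of d' d] power2_eq_square algebra_simps)
  also have "(S - \<sigma>) * (d \<bullet> d + 2 * (d \<bullet> d') + d' \<bullet> d' - (e \<bullet> d + e \<bullet> d')\<^sup>2) + (T - \<sigma>) * (e \<bullet> d - e \<bullet> d')\<^sup>2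
      = ((S - \<sigma>) * (d \<bullet> d) + (T - S) * (e \<bullet> d)\<^sup>2)
        + 2 * ((S - \<sigma>) * (d \<bullet> d') - (S + T - 2 * \<sigma>) * (e \<bullet> d') * (e \<bullet> d))
        + ((S - \<sigma>) * (d' \<bullet> d') + (T - S) * (e \<bullet> d')\<^sup>2)"
    by (simp add: power2_eq_square algebra_simps)
  also have "(S - \<sigma>) * (d \<bullet> d') - (S + T - 2 * \<sigma>) * (e \<bullet> d') * (e \<bullet> d)
      = ((S - \<sigma>) *\<^sub>R d' - ((S + T - 2 * \<sigma>) * (e \<bullet> d')) *\<^sub>R e) \<bullet> d"
    by (simp add: inner_diff_left inner_commute[of d' d])
  finally show ?thesis using m m' by linarith
qed

lemma trace_rank_one_perturbation:
  fixes e :: "'a::euclidean_space"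
  assumes "norm e = 1"
  shows "(\<Sum>b\<in>Basis. (c *\<^sub>R b + (k * (e \<bullet> b)) *\<^sub>R e) \<bullet> b) = c * DIM('a) + k"
proof -
  have "(c *\<^sub>R b + (k * (e \<bullet> b)) *\<^sub>R e) \<bullet> b = c + k * ((e \<bullet> b) * (e \<bullet> b))" if "b \<in> Basis" for b
    using that by (simp add: inner_add_left)
  moreover have "(\<Sum>b\<in>Basis. (e \<bullet> b) * (e \<bullet> b)) = 1"
    using assms by (simp add: dot_square_norm flip: euclidean_inner)
  ultimately show ?thesis
    by (simp add: sum.distrib mult.commute flip: sum_distrib_left)
qed

text \<open>\<open>Z\<close> is the Hessian of the penalty, with eigenvalue \<mu> across
  \<open>e\<close> and \<open>- (1 - \<alpha>) * \<mu>\<close> along \<open>e\<close>. Without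
  errors the transverse contributions cancel against \<open>B\<close>, while along \<open>e\<close>
  the reflection makes all terms add up to \<open>- 4 * (1 - \<alpha>) * T * \<mu>\<close>. The
  shifts \<open>4 * \<epsilon>\<close> and \<open>2 * \<epsilon>\<close> are the Hessians of the
  quadratic penalties in x and in y.\<close>

lemma coupled_trace_bound:
  fixes e :: "'a::euclidean_space" and D :: "'a \<Rightarrow> 'a" and S T \<alpha> \<mu> \<sigma> \<epsilon> :: real
  assumes e: "norm e = 1" and D: "\<And>v. norm (D v - (S *\<^sub>R v + ((T - S) * (e \<bullet> v)) *\<^sub>R e)) \<le> \<sigma> * norm v"
    and \<alpha>: "0 < \<alpha>" "\<alpha> < 1" and \<mu>: "\<mu> > 0" "0 \<le> \<epsilon>" "4 * \<epsilon> \<le> \<mu>" and \<sigma>: "0 \<le> \<sigma>"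
    and s1: "6 * real DIM('a) * \<sigma> \<le> (1 - \<alpha>) * T"
    and s2: "6 * \<epsilon> * (S * (real DIM('a) - 1) + T) \<le> (1 - \<alpha>) * T * \<mu>"
    and Z: "\<And>v. Z v = \<mu> *\<^sub>R (v - ((2 - \<alpha>) * (e \<bullet> v)) *\<^sub>R e)"
    and D0: "\<And>v. D0 v = S *\<^sub>R v + ((T - S) * (e \<bullet> v)) *\<^sub>R e"
    and B: "\<And>v. B v = (S - \<sigma>) *\<^sub>R v - ((S + T - 2 * \<sigma>) * (e \<bullet> v)) *\<^sub>R e"
  shows "(\<Sum>b\<in>Basis. D (Z b + (4 * \<epsilon>) *\<^sub>R b) \<bullet> b) - 2 * (\<Sum>b\<in>Basis. B (Z b) \<bullet> b)
      + (\<Sum>b\<in>Basis. D0 (Z b + (2 * \<epsilon>) *\<^sub>R b) \<bullet> b) \<le> - (2 * (1 - \<alpha>) * T * \<mu>)"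
proof -
  have ee: "e \<bullet> e = 1" using e by (simp add: dot_square_norm)
  have D0Z: "D0 (Z b + c *\<^sub>R b) = (S * (\<mu> + c)) *\<^sub>R b + ((\<mu> * ((\<alpha> - 1) * T - S) + (T - S) * c) * (e \<bullet> b)) *\<^sub>R e" for b c
  proof -
    have eZ: "e \<bullet> (Z b + c *\<^sub>R b) = (\<mu> * (\<alpha> - 1) + c) * (e \<bullet> b)"
      by (simp add: Z inner_add_right inner_diff_right ee algebra_simps)
    show ?thesis unfolding D0 eZ
      by (simp add: Z algebra_simps, simp add: algebra_simps flip: scaleR_add_left)
  qed
  have BZ: "B (Z b) = ((S - \<sigma>) * \<mu>) *\<^sub>R b + ((\<mu> * ((1 - \<alpha>) * (T - \<sigma>) - (S - \<sigma>))) * (e \<bullet> b)) *\<^sub>R e" for b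
  proof -
    have eZ: "e \<bullet> Z b = (\<mu> * (\<alpha> - 1)) * (e \<bullet> b)"
      by (simp add: Z inner_diff_right ee algebra_simps)
    show ?thesis unfolding B eZ
      by (simp add: Z algebra_simps, simp add: algebra_simps flip: scaleR_add_left)
  qed
  let ?N = "real DIM('a)"
  \<comment> \<open>Cost of freezing the Jacobian: the argument has norm at most
    \<open>4 * \<mu>\<close>, because \<open>norm (Z b) \<le> 3 * \<mu>\<close> and
    \<open>4 * \<epsilon> \<le> \<mu>\<close>.\<close>
  have "D (Z b + (4 * \<epsilon>) *\<^sub>R b) \<bullet> b \<le> D0 (Z b + (4 * \<epsilon>) *\<^sub>R b) \<bullet> b + 4 * \<sigma> * \<mu>" if b: "b \<in> Basis" for b
  proof -
    define v where "v = Z b + (4 * \<epsilon>) *\<^sub>R b"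
    have eb: "\<bar>e \<bullet> b\<bar> \<le> 1" using Cauchy_Schwarz_ineq2[of e b] e b by simp
    have "\<bar>2 - \<alpha>\<bar> * \<bar>e \<bullet> b\<bar> \<le> 2 * 1"
      using eb \<alpha> by (intro mult_mono) auto
    then have "norm (((2 - \<alpha>) * (e \<bullet> b)) *\<^sub>R e) \<le> 2"
      using e by (simp add: abs_mult)
    then have "norm (b - ((2 - \<alpha>) * (e \<bullet> b)) *\<^sub>R e) \<le> 3"
      using norm_triangle_ineq4[of b "((2 - \<alpha>) * (e \<bullet> b)) *\<^sub>R e"] b by simp
    then have "norm (Z b) \<le> \<mu> * 3"
      unfolding Z using \<mu> by (simp add: mult_left_mono)
    then have "norm v \<le> 4 * \<mu>"
      using norm_triangle_ineq[of "Z b" "(4 * \<epsilon>) *\<^sub>R b"] b \<mu> by (simp add: v_def)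
    then have "\<sigma> * norm v \<le> \<sigma> * (4 * \<mu>)" using \<sigma> by (rule mult_left_mono)
    then have "norm (D v - D0 v) \<le> 4 * \<sigma> * \<mu>" using D[of v] by (simp add: D0 mult_ac)
    moreover have "(D v - D0 v) \<bullet> b \<le> norm (D v - D0 v)"
      using norm_cauchy_schwarz[of "D v - D0 v" b] b by simp
    ultimately show ?thesis by (simp add: v_def inner_diff_left)
  qed
  then have "(\<Sum>b\<in>Basis. D (Z b + (4 * \<epsilon>) *\<^sub>R b) \<bullet> b) \<le> (\<Sum>b\<in>Basis. D0 (Z b + (4 * \<epsilon>) *\<^sub>R b) \<bullet> b + 4 * \<sigma> * \<mu>)"
    by (rule sum_mono)
  also have "\<dots> = (\<Sum>b\<in>Basis. D0 (Z b + (4 * \<epsilon>) *\<^sub>R b) \<bullet> b) + ?N * (4 * \<sigma> * \<mu>)"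
    by (simp add: sum.distrib)
  finally have "(\<Sum>b\<in>Basis. D (Z b + (4 * \<epsilon>) *\<^sub>R b) \<bullet> b) - 2 * (\<Sum>b\<in>Basis. B (Z b) \<bullet> b)
      + (\<Sum>b\<in>Basis. D0 (Z b + (2 * \<epsilon>) *\<^sub>R b) \<bullet> b)
      \<le> S * (\<mu> + 4 * \<epsilon>) * ?N + (\<mu> * ((\<alpha> - 1) * T - S) + (T - S) * (4 * \<epsilon>)) + ?N * (4 * \<sigma> * \<mu>)
        - 2 * ((S - \<sigma>) * \<mu> * ?N + \<mu> * ((1 - \<alpha>) * (T - \<sigma>) - (S - \<sigma>)))
        + (S * (\<mu> + 2 * \<epsilon>) * ?N + (\<mu> * ((\<alpha> - 1) * T - S) + (T - S) * (2 * \<epsilon>)))"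
    unfolding D0Z BZ trace_rank_one_perturbation[OF e] by linarith
  also have "\<dots> = 6 * ?N * \<sigma> * \<mu> - 2 * \<alpha> * \<sigma> * \<mu> - 4 * (1 - \<alpha>) * T * \<mu> + 6 * \<epsilon> * (S * (?N - 1) + T)"
    by (simp add: algebra_simps)
  \<comment> \<open>Each of \<open>s1\<close> and \<open>s2\<close> gives up one quarter of the
    negative term, leaving half of it.\<close>
  also have "\<dots> \<le> (1 - \<alpha>) * T * \<mu> - 0 - 4 * (1 - \<alpha>) * T * \<mu> + (1 - \<alpha>) * T * \<mu>"
  proof -
    have "6 * ?N * \<sigma> * \<mu> \<le> (1 - \<alpha>) * T * \<mu>" using s1 \<mu> by (simp add: mult_right_mono)
    moreover have "0 \<le> 2 * \<alpha> * \<sigma> * \<mu>" using \<alpha> \<mu> \<sigma> by simp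
    moreover have "6 * \<epsilon> * (S * (?N - 1) + T) \<le> (1 - \<alpha>) * T * \<mu>"
      using s2 .
    ultimately show ?thesis by linarith
  qed
  finally show ?thesis by (simp add: algebra_simps)
qed

section \<open>The flux of the sum of the two Laplacians, and the contradiction at a two-point
  maximum\<close>

definition pq_field :: "real \<Rightarrow> real \<Rightarrow> 'a::real_inner \<Rightarrow> 'a" where
  "pq_field p q v = power_field p v + power_field q v"

definition pq_field_deriv :: "real \<Rightarrow> real \<Rightarrow> 'a::real_inner \<Rightarrow> 'a \<Rightarrow> 'a" where
  "pq_field_deriv p q \<xi> v = power_field_deriv p \<xi> v + power_field_deriv q \<xi> v"

text \<open>The sum is not homogeneous; measuring the error against the sum of both powers of
  \<open>w\<close> nevertheless keeps \<tau> independent of \<open>w\<close>.\<close>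

lemma pq_field_deriv_uniform_cone:
  assumes "\<delta> > 0"
  obtains \<tau> where "0 < \<tau>" "\<tau> < 1"
    "\<And>w (e::'a::real_inner) \<xi> v. \<lbrakk>w > 0; norm e = 1; norm (\<xi> - w *\<^sub>R e) \<le> \<tau> * w\<rbrakk>
      \<Longrightarrow> norm (pq_field_deriv p q \<xi> v - pq_field_deriv p q (w *\<^sub>R e) v)
        \<le> \<delta> * (w powr (p - 2) + w powr (q - 2)) * norm v"
proof -
  obtain \<tau>1 where 1: "0 < \<tau>1" "\<tau>1 < 1"
    "\<And>w (e::'a::real_inner) \<xi> v. \<lbrakk>w > 0; norm e = 1; norm (\<xi> - w *\<^sub>R e) \<le> \<tau>1 * w\<rbrakk>
      \<Longrightarrow> norm (power_field_deriv p \<xi> v - power_field_deriv p (w *\<^sub>R e) v) \<le> \<delta> * w powr (p - 2) * norm v"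
    using power_field_deriv_uniform_cone[OF assms, where s = p and 'a = 'a] by metis
  obtain \<tau>2 where 2: "0 < \<tau>2" "\<tau>2 < 1"
    "\<And>w (e::'a::real_inner) \<xi> v. \<lbrakk>w > 0; norm e = 1; norm (\<xi> - w *\<^sub>R e) \<le> \<tau>2 * w\<rbrakk>
      \<Longrightarrow> norm (power_field_deriv q \<xi> v - power_field_deriv q (w *\<^sub>R e) v) \<le> \<delta> * w powr (q - 2) * norm v"
    using power_field_deriv_uniform_cone[OF assms, where s = q and 'a = 'a] by metis
  show thesis
  proof (rule that[of "min \<tau>1 \<tau>2"])
    fix w :: real and e \<xi> v :: 'a
    assume w: "w > 0" "norm e = 1" and \<xi>: "norm (\<xi> - w *\<^sub>R e) \<le> min \<tau>1 \<tau>2 * w"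
    have "min \<tau>1 \<tau>2 * w \<le> \<tau>1 * w" "min \<tau>1 \<tau>2 * w \<le> \<tau>2 * w"
      using w by (auto intro: mult_right_mono)
    then have "norm (power_field_deriv p \<xi> v - power_field_deriv p (w *\<^sub>R e) v)
        + norm (power_field_deriv q \<xi> v - power_field_deriv q (w *\<^sub>R e) v)
        \<le> \<delta> * w powr (p - 2) * norm v + \<delta> * w powr (q - 2) * norm v"
      using \<xi> by (intro add_mono 1(3) 2(3) w) auto
    moreover have "pq_field_deriv p q \<xi> v - pq_field_deriv p q (w *\<^sub>R e) v
        = (power_field_deriv p \<xi> v - power_field_deriv p (w *\<^sub>R e) v)
        + (power_field_deriv q \<xi> v - power_field_deriv q (w *\<^sub>R e) v)"
      by (simp add: pq_field_deriv_def)
    ultimately show "norm (pq_field_deriv p q \<xi> v - pq_field_deriv p q (w *\<^sub>R e) v)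
        \<le> \<delta> * (w powr (p - 2) + w powr (q - 2)) * norm v"
      by (metis (no_types, lifting) norm_triangle_le distrib_left distrib_right)
  qed (use 1 2 in auto)
qed

lemma has_derivative_pq_field:
  "\<xi> \<noteq> 0 \<Longrightarrow> (pq_field p q has_derivative pq_field_deriv p q \<xi>) (at \<xi>)"
  unfolding pq_field_def[abs_def] pq_field_deriv_def[abs_def]
  by (intro has_derivative_add has_derivative_power_field)

lemma continuous_on_pq_field: "p > 1 \<Longrightarrow> q > 1 \<Longrightarrow> continuous_on S (pq_field p q)"
  unfolding pq_field_def[abs_def] by (intro continuous_intros continuous_on_power_field)

lemma continuous_on_pq_field_deriv:
  assumes "continuous_on S h" "continuous_on S k" "\<And>x. x \<in> S \<Longrightarrow> h x \<noteq> 0"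
  shows "continuous_on S (\<lambda>x. pq_field_deriv p q (h x) (k x))"
  unfolding pq_field_deriv_def by (intro continuous_intros continuous_on_power_field_deriv assms)

text \<open>At the maximum the first-order conditions place all gradients near
  \<open>w *\<^sub>R e\<close>, and the trace bound beats the difference of the sources. Both facts
  are open conditions, so they persist on a product of small balls, where
  \<open>no_weak_two_point_contact\<close> applies.\<close>

lemma no_weak_two_point_maximum:
  fixes u :: "'a::euclidean_space \<Rightarrow> real" and Du :: "'a \<Rightarrow> 'a"
    and \<alpha> \<kappa> \<epsilon> w S T \<mu> \<delta> \<tau> :: real
  assumes p: "p > 1" and q: "q > 1"
    and du: "\<And>x. (u has_derivative (\<lambda>h. Du x \<bullet> h)) (at x)"
    and cDu: "continuous_on UNIV Du" and cF: "continuous_on UNIV F"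
    and weak: "\<And>\<phi> D\<phi>. \<lbrakk>\<And>x. (\<phi> has_derivative (\<lambda>h. D\<phi> x \<bullet> h)) (at x); continuous_on UNIV D\<phi>;
        compact (closure {x. \<phi> x \<noteq> 0})\<rbrakk>
        \<Longrightarrow> (\<integral>x. pq_field p q (Du x) \<bullet> D\<phi> x \<partial>lborel) = (\<integral>x. F x * \<phi> x \<partial>lborel)"
    and \<alpha>: "0 < \<alpha>" "\<alpha> < 1" and \<kappa>: "\<kappa> > 0" and \<epsilon>: "\<epsilon> > 0" and xy: "x0 \<noteq> y0"
    and max: "\<And>x y. u x - u y - \<kappa> * norm (x - y) powr \<alpha> - \<epsilon> * (x \<bullet> x)
        \<le> u x0 - u y0 - \<kappa> * norm (x0 - y0) powr \<alpha> - \<epsilon> * (x0 \<bullet> x0)"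
    and w: "w = \<kappa> * \<alpha> * norm (x0 - y0) powr (\<alpha> - 1)"
    and S: "S = w powr (p - 2) + w powr (q - 2)"
    and T: "T = (p - 1) * w powr (p - 2) + (q - 1) * w powr (q - 2)"
    and \<mu>: "\<mu> = w / norm (x0 - y0)"
    and \<delta>: "0 < \<delta>" "\<delta> * S \<le> S" "\<delta> * S \<le> T" "6 * real DIM('a) * (\<delta> * S) \<le> (1 - \<alpha>) * T"
    and cone: "\<tau> < 1"
      "\<And>(e::'a) \<xi> v. \<lbrakk>norm e = 1; norm (\<xi> - w *\<^sub>R e) \<le> \<tau> * w\<rbrakk>
        \<Longrightarrow> norm (pq_field_deriv p q \<xi> v - pq_field_deriv p q (w *\<^sub>R e) v) \<le> \<delta> * S * norm v"
    and small: "4 * \<epsilon> \<le> \<mu>" "6 * \<epsilon> * (S * (real DIM('a) - 1) + T) \<le> (1 - \<alpha>) * T * \<mu>"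
      "2 * \<epsilon> * norm x0 < \<tau> * w"
    and F: "\<lbrakk>norm (Du x0) \<le> 2 * w; norm (Du y0) \<le> w\<rbrakk> \<Longrightarrow> F x0 - F y0 < 2 * (1 - \<alpha>) * T * \<mu>"
  shows False
proof -
  let ?DA = "pq_field_deriv p q" and ?A = "pq_field p q"
  define r where "r = norm (x0 - y0)"
  define e where "e = sgn (x0 - y0)"
  have r: "r > 0" using xy by (simp add: r_def)
  have e: "norm e = 1" using xy by (simp add: e_def norm_sgn)
  have w0: "w > 0" using \<kappa> \<alpha> r by (simp add: w r_def)
  have \<mu>0: "\<mu> > 0" using w0 r by (simp add: \<mu> r_def)
  have \<tau>w: "\<tau> * w > 0" using small(3) \<epsilon> by (smt (verit) mult_nonneg_nonneg norm_ge_zero)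
  \<comment> \<open>\<open>P\<close> and \<open>- Q\<close> are the partial gradients of everything
    subtracted from \<open>u x - u y\<close> in \<Phi>. \<open>Z\<close> is the Hessian of the
    concave penalty and also the x-derivative of \<open>Q\<close>. \<open>B\<close> is the
    reflection coupling with \<sigma> = \<delta> * S.\<close>
  define P where "P x y = (\<kappa> * \<alpha>) *\<^sub>R power_field \<alpha> (x - y) + (2 * \<epsilon>) *\<^sub>R x + (2 * \<epsilon>) *\<^sub>R (x - x0)" for x y
  define Q where "Q x y = (\<kappa> * \<alpha>) *\<^sub>R power_field \<alpha> (x - y) - (2 * \<epsilon>) *\<^sub>R (y - y0)" for x y
  define Z where "Z x y h = (\<kappa> * \<alpha>) *\<^sub>R power_field_deriv \<alpha> (x - y) h" for x y h :: 'a
  define AP where "AP x y h = ?DA (P x y) (Z x y h + (4 * \<epsilon>) *\<^sub>R h)" for x y h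
  define AQ where "AQ x y h = ?DA (Q x y) (- Z x y h - (2 * \<epsilon>) *\<^sub>R h)" for x y h
  define B where "B v = (S - \<delta> * S) *\<^sub>R v - ((S + T - 2 * (\<delta> * S)) * (e \<bullet> v)) *\<^sub>R e" for v
  \<comment> \<open>The last two terms make the maximum strict. They vanish to second order at
    \<open>(x0, y0)\<close>, so the first-order conditions there are unchanged.\<close>
  define \<Phi> where "\<Phi> x y = u x - u y - \<kappa> * norm (x - y) powr \<alpha> - \<epsilon> * (x \<bullet> x)
      - \<epsilon> * ((x - x0) \<bullet> (x - x0)) - \<epsilon> * ((y - y0) \<bullet> (y - y0))" for x y
  have B: "bounded_linear B"
    unfolding B_def by (intro bounded_linear_intros)
  have we: "w *\<^sub>R e = (\<kappa> * \<alpha>) *\<^sub>R power_field \<alpha> (x0 - y0)"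
  proof -
    have "r powr (\<alpha> - 1) = r powr (\<alpha> - 2) * r"
      using powr_add[of r "\<alpha> - 2" 1] r by simp
    then show ?thesis
      using r by (simp add: w e_def power_field_def sgn_div_norm flip: r_def)
  qed
  have Z0: "Z x0 y0 h = \<mu> *\<^sub>R (h - ((2 - \<alpha>) * (e \<bullet> h)) *\<^sub>R e)" for h
  proof -
    have "r powr (\<alpha> - 2) = r powr (\<alpha> - 1) / r"
      using powr_diff[of r "\<alpha> - 1" 1] r by simp
    then have "\<mu> = \<kappa> * \<alpha> * r powr (\<alpha> - 2)" by (simp add: \<mu> w flip: r_def)
    then show ?thesis
      by (simp add: Z_def power_field_deriv_def algebra_simps flip: r_def e_def)
  qed
  have DA0: "?DA (w *\<^sub>R e) v = S *\<^sub>R v + ((T - S) * (e \<bullet> v)) *\<^sub>R e" for v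
    unfolding pq_field_deriv_def power_field_deriv_scaled_unit[OF e w0] S T
    by (simp add: algebra_simps)
  have zder: "((\<lambda>x. x - y) has_derivative (\<lambda>h. h)) (at x)" "((\<lambda>y. x - y) has_derivative (\<lambda>h. - h)) (at y)"
    for x y :: 'a
    by (auto intro!: derivative_eq_intros)
  have \<Phi>x: "((\<lambda>x. \<Phi> x y) has_derivative (\<lambda>h. (Du x - P x y) \<bullet> h)) (at x)" if "x \<noteq> y" for x y
  proof -
    have "((\<lambda>x. norm (x - y) powr \<alpha>) has_derivative (\<lambda>h. \<alpha> * (power_field \<alpha> (x - y) \<bullet> h))) (at x)"
      using has_derivative_compose[OF zder(1) has_derivative_norm_powr_power_field] that by simp
    then have "((\<lambda>x. \<Phi> x y) has_derivative (\<lambda>h. Du x \<bullet> h - 0 - \<kappa> * (\<alpha> * (power_field \<alpha> (x - y) \<bullet> h))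
        - \<epsilon> * (x \<bullet> h + h \<bullet> x) - \<epsilon> * ((x - x0) \<bullet> h + h \<bullet> (x - x0)) - 0)) (at x)"
      unfolding \<Phi>_def
      by (intro has_derivative_diff has_derivative_mult_right has_derivative_inner du zder
          has_derivative_ident has_derivative_const)
    then show ?thesis
      by (rule has_derivative_eq_rhs)
        (simp add: fun_eq_iff P_def inner_diff_left inner_add_left inner_commute algebra_simps)
  qed
  have \<Phi>y: "(\<Phi> x has_derivative (\<lambda>h. (Q x y - Du y) \<bullet> h)) (at y)" if "x \<noteq> y" for x y
  proof -
    have "((\<lambda>y. norm (x - y) powr \<alpha>) has_derivative (\<lambda>h. \<alpha> * (power_field \<alpha> (x - y) \<bullet> - h))) (at y)"
      using has_derivative_compose[OF zder(2) has_derivative_norm_powr_power_field] that by simp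
    then have "((\<lambda>y. \<Phi> x y) has_derivative (\<lambda>h. 0 - Du y \<bullet> h - \<kappa> * (\<alpha> * (power_field \<alpha> (x - y) \<bullet> - h))
        - 0 - 0 - \<epsilon> * ((y - y0) \<bullet> h + h \<bullet> (y - y0)))) (at y)"
      unfolding \<Phi>_def
      by (intro has_derivative_diff has_derivative_mult_right has_derivative_inner du zder
          has_derivative_ident has_derivative_const)
    then show ?thesis
      by (rule has_derivative_eq_rhs)
        (simp add: fun_eq_iff Q_def inner_diff_left inner_add_left inner_commute algebra_simps)
  qed
  have \<Phi>max: "\<Phi> x y \<le> \<Phi> x0 y0 - \<epsilon> * ((x - x0) \<bullet> (x - x0)) - \<epsilon> * ((y - y0) \<bullet> (y - y0))" for x y
    using max[of x y] by (simp add: \<Phi>_def)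
  have nn: "0 \<le> \<epsilon> * (v \<bullet> v)" for v :: 'a using \<epsilon> by simp
  have \<Phi>le: "\<Phi> x y \<le> \<Phi> x0 y0" for x y
    using \<Phi>max[of x y] nn[of "x - x0"] nn[of "y - y0"] by linarith
  have Du0: "Du x0 = P x0 y0" "Du y0 = Q x0 y0"
  proof -
    have "(\<lambda>h. (Du x0 - P x0 y0) \<bullet> h) = (\<lambda>h. 0)"
      by (rule differential_zero_maxmin[OF UNIV_I open_UNIV \<Phi>x[OF xy]]) (simp add: \<Phi>le)
    moreover have "(\<lambda>h. (Q x0 y0 - Du y0) \<bullet> h) = (\<lambda>h. 0)"
      by (rule differential_zero_maxmin[OF UNIV_I open_UNIV \<Phi>y[OF xy]]) (simp add: \<Phi>le)
    ultimately show "Du x0 = P x0 y0" "Du y0 = Q x0 y0"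
      by (metis inner_eq_zero_iff right_minus_eq)+
  qed
  have Q0: "Q x0 y0 = w *\<^sub>R e" by (simp add: Q_def we)
  have P0: "P x0 y0 = w *\<^sub>R e + (2 * \<epsilon>) *\<^sub>R x0" by (simp add: P_def we)
  define N where "N x y = F x - F y + (\<Sum>b\<in>Basis. AP x y b \<bullet> b) - 2 * (\<Sum>b\<in>Basis. B (Z x y b) \<bullet> b)
        - (\<Sum>b\<in>Basis. AQ x y b \<bullet> b)" for x y
  have N0: "N x0 y0 < 0"
  proof -
    have "norm (?DA (P x0 y0) v - (S *\<^sub>R v + ((T - S) * (e \<bullet> v)) *\<^sub>R e)) \<le> \<delta> * S * norm v" for v
      using cone(2)[OF e, of "P x0 y0" v] small(3) \<epsilon> by (simp add: P0 DA0)
    from coupled_trace_bound[OF e this \<alpha> \<mu>0 less_imp_le[OF \<epsilon>] small(1) _ \<delta>(4) small(2) Z0 DA0 B_def]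
    have "(\<Sum>b\<in>Basis. AP x0 y0 b \<bullet> b) - 2 * (\<Sum>b\<in>Basis. B (Z x0 y0 b) \<bullet> b)
        + (\<Sum>b\<in>Basis. ?DA (w *\<^sub>R e) (Z x0 y0 b + (2 * \<epsilon>) *\<^sub>R b) \<bullet> b) \<le> - (2 * (1 - \<alpha>) * T * \<mu>)"
      using \<delta>(1) by (simp add: AP_def S)
    \<comment> \<open>Differentiating \<open>Q\<close> in y reverses the sign of \<open>Z\<close>,
      so subtracting \<open>AQ\<close> produces the third sum of the trace bound.\<close>
    moreover have "AQ x0 y0 b = - ?DA (w *\<^sub>R e) (Z x0 y0 b + (2 * \<epsilon>) *\<^sub>R b)" for b
      unfolding AQ_def Q0 DA0 by (simp add: algebra_simps inner_add_right inner_diff_right)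
    then have "(\<Sum>b\<in>Basis. AQ x0 y0 b \<bullet> b) = - (\<Sum>b\<in>Basis. ?DA (w *\<^sub>R e) (Z x0 y0 b + (2 * \<epsilon>) *\<^sub>R b) \<bullet> b)"
      by (simp add: sum_negf)
    moreover have "norm (Du x0) \<le> 2 * w"
    proof -
      have "norm (Du x0) \<le> norm (w *\<^sub>R e) + norm ((2 * \<epsilon>) *\<^sub>R x0)"
        unfolding Du0 P0 by (rule norm_triangle_ineq)
      also have "\<dots> \<le> w + \<tau> * w" using e w0 \<epsilon> small(3) by simp
      also have "\<dots> \<le> 2 * w" using cone(1) w0 by simp
      finally show ?thesis .
    qed
    moreover have "norm (Du y0) \<le> w" unfolding Du0 Q0 using e w0 by simp
    ultimately show ?thesis
      unfolding N_def using F by linarith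
  qed
  let ?C = "ball (w *\<^sub>R e) (\<tau> * w)"
  have C0: "0 \<notin> ?C"
    using e w0 cone(1) by simp
  define G :: "('a \<times> 'a) set" where "G = {z. fst z \<noteq> snd z}"
  have oG: "open G"
  proof -
    have "G = {z. dist (fst z) (snd z) > 0}" by (auto simp: G_def)
    also have "open \<dots>" by (intro open_Collect_less continuous_intros)
    finally show ?thesis .
  qed
  have cz: "continuous_on D (\<lambda>z. power_field \<alpha> (fst z - snd z))" if "D \<subseteq> G" for D :: "('a \<times> 'a) set"
    unfolding power_field_def using that by (intro continuous_intros) (auto simp: G_def)
  have cP: "continuous_on D (\<lambda>z. P (fst z) (snd z))" and cQ: "continuous_on D (\<lambda>z. Q (fst z) (snd z))"
    if "D \<subseteq> G" for D :: "('a \<times> 'a) set"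
    unfolding P_def Q_def by (intro continuous_intros cz that)+
  have cD1: "continuous_on D (\<lambda>z. Du (fst z))" and cD2: "continuous_on D (\<lambda>z. Du (snd z))"
    for D :: "('a \<times> 'a) set"
    by (auto intro!: continuous_intros continuous_on_compose2[OF cDu])
  have cu: "continuous_on UNIV u"
    by (rule has_derivative_continuous_on[OF has_derivative_at_withinI[OF du]])
  have c\<Phi>: "continuous_on D (\<lambda>z. \<Phi> (fst z) (snd z))" if "D \<subseteq> G" for D :: "('a \<times> 'a) set"
    unfolding \<Phi>_def using that
    by (intro continuous_intros continuous_on_compose2[OF cu]) (auto simp: G_def)
  \<comment> \<open>Continuity of \<open>Du\<close> makes it an open condition that the actual
    gradients, as well as those of the penalty, lie in the good ball.\<close>
  define G1 where "G1 = G \<inter> (\<lambda>z. (P (fst z) (snd z), Q (fst z) (snd z), Du (fst z), Du (snd z))) -` (?C \<times> ?C \<times> ?C \<times> ?C)"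
  have oG1: "open G1"
    unfolding G1_def
    by (intro continuous_open_preimage oG continuous_intros cP cQ cD1 cD2 open_Times) auto
  have G1: "G1 \<subseteq> G" by (auto simp: G1_def)
  have cZ: "continuous_on D (\<lambda>z. Z (fst z) (snd z) b)" if "D \<subseteq> G" for D :: "('a \<times> 'a) set" and b
    unfolding Z_def using that
    by (intro continuous_intros continuous_on_power_field_deriv) (auto simp: G_def)
  have PQ0: "P (fst z) (snd z) \<noteq> 0" "Q (fst z) (snd z) \<noteq> 0" if "z \<in> G1" for z
    using that C0 by (auto simp: G1_def)
  have cAP: "continuous_on D (\<lambda>z. AP (fst z) (snd z) b)" and cAQ: "continuous_on D (\<lambda>z. AQ (fst z) (snd z) b)"
    if "D \<subseteq> G1" for D :: "('a \<times> 'a) set" and b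
    unfolding AP_def AQ_def using that G1 PQ0
    by (auto intro!: continuous_on_pq_field_deriv continuous_intros cZ cP cQ)
  have cN: "continuous_on G1 (\<lambda>z. N (fst z) (snd z))"
    unfolding N_def
    by (intro continuous_intros cAP cAQ bounded_linear.continuous_on[OF B] cZ G1 order_refl
        continuous_on_compose2[OF cF]) auto
  define G2 where "G2 = G1 \<inter> (\<lambda>z. N (fst z) (snd z)) -` {..<0}"
  have oG2: "open G2"
    unfolding G2_def by (intro continuous_open_preimage oG1 cN) auto
  have "(x0, y0) \<in> G2"
    using N0 xy \<tau>w small(3) \<epsilon> by (auto simp: G2_def G1_def G_def Du0 Q0 P0 dist_norm)
  then obtain U V where "open U" "open V" "x0 \<in> U" "y0 \<in> V" and UV: "U \<times> V \<subseteq> G2"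
    using open_prod_elim[OF oG2] by (metis mem_Sigma_iff)
  then obtain \<rho>1 \<rho>2 where \<rho>1: "\<rho>1 > 0" "ball x0 \<rho>1 \<subseteq> U" and \<rho>2: "\<rho>2 > 0" "ball y0 \<rho>2 \<subseteq> V"
    by (meson open_contains_ball)
  define \<rho> where "\<rho> = min \<rho>1 \<rho>2"
  have \<rho>: "\<rho> > 0" using \<rho>1 \<rho>2 by (simp add: \<rho>_def)
  have "ball x0 \<rho> \<times> ball y0 \<rho> \<subseteq> U \<times> V" using \<rho>1 \<rho>2 by (force simp: \<rho>_def)
  then have XY: "ball x0 \<rho> \<times> ball y0 \<rho> \<subseteq> G2" using UV by blast
  then have XY1: "ball x0 \<rho> \<times> ball y0 \<rho> \<subseteq> G1" and XYG: "ball x0 \<rho> \<times> ball y0 \<rho> \<subseteq> G"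
    using G1 by (auto simp: G2_def)
  have good: "x \<noteq> y" "P x y \<in> ?C" "Q x y \<in> ?C" "Du x \<in> ?C" "Du y \<in> ?C" "N x y < 0" "P x y \<noteq> 0" "Q x y \<noteq> 0"
    if "x \<in> ball x0 \<rho>" "y \<in> ball y0 \<rho>" for x y
  proof -
    have "(x, y) \<in> G2" using that XY by blast
    then show "x \<noteq> y" "P x y \<in> ?C" "Q x y \<in> ?C" "Du x \<in> ?C" "Du y \<in> ?C" "N x y < 0" "P x y \<noteq> 0" "Q x y \<noteq> 0"
      using C0 by (auto simp: G2_def G1_def G_def simp del: mem_ball)
  qed
  have mono: "(S - \<delta> * S) * ((\<xi> - \<eta>) \<bullet> (\<xi> - \<eta>)) + (T - S) * (e \<bullet> (\<xi> - \<eta>))\<^sup>2 \<le> (?A \<xi> - ?A \<eta>) \<bullet> (\<xi> - \<eta>)"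
    if "\<xi> \<in> ?C" "\<eta> \<in> ?C" for \<xi> \<eta>
  proof (rule inner_diff_ge_of_derivative[OF convex_ball _ that])
    fix \<zeta> assume \<zeta>: "\<zeta> \<in> ?C"
    then show "(?A has_derivative ?DA \<zeta>) (at \<zeta>)"
      using C0 by (intro has_derivative_pq_field) auto
    define d where "d = \<xi> - \<eta>"
    have "norm (\<zeta> - w *\<^sub>R e) \<le> \<tau> * w"
      using \<zeta> by (simp add: dist_norm norm_minus_commute)
    then have "norm (?DA \<zeta> d - ?DA (w *\<^sub>R e) d) * norm d \<le> \<delta> * S * norm d * norm d"
      by (intro mult_right_mono cone(2)[OF e]) auto
    moreover have "(?DA (w *\<^sub>R e) d - ?DA \<zeta> d) \<bullet> d \<le> norm (?DA \<zeta> d - ?DA (w *\<^sub>R e) d) * norm d"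
      using norm_cauchy_schwarz[of "?DA (w *\<^sub>R e) d - ?DA \<zeta> d" d] by (simp add: norm_minus_commute)
    moreover have "?DA (w *\<^sub>R e) d \<bullet> d = S * (d \<bullet> d) + (T - S) * (e \<bullet> d)\<^sup>2"
      unfolding DA0 by (simp add: inner_add_left power2_eq_square)
    moreover have "norm d * norm d = d \<bullet> d"
      by (simp add: dot_square_norm power2_eq_square)
    ultimately show "(S - \<delta> * S) * (d \<bullet> d) + (T - S) * (e \<bullet> d)\<^sup>2 \<le> ?DA \<zeta> d \<bullet> d"
      by (simp add: inner_diff_left algebra_simps)
  qed
  \<comment> \<open>By \<open>\<Phi>max\<close>, lying less than \<open>t\<close> below the maximum
    forces both points into the closed balls of radius \<rho>/2; these are the compact sets carrying
    the test function.\<close>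
  define t where "t = \<epsilon> * (\<rho> / 2)\<^sup>2"
  have t: "t > 0" using \<epsilon> \<rho> by (simp add: t_def)
  define W where "W x y = \<Phi> x y - (\<Phi> x0 y0 - t)" for x y
  show False
  proof (rule no_weak_two_point_contact[where A = ?A and w = W and P = P and Q = Q and AP = AP and QX = Z and AQ = AQ
        and F = F and Du = Du and B = B and X = "ball x0 \<rho>" and Y = "ball y0 \<rho>"
        and K = "cball x0 (\<rho>/2)" and L = "cball y0 (\<rho>/2)"])
    show "cball x0 (\<rho>/2) \<subseteq> ball x0 \<rho>" "cball y0 (\<rho>/2) \<subseteq> ball y0 \<rho>"
      using \<rho> by (auto simp: subset_iff)
    show "W x0 y0 > 0" using t by (simp add: W_def)
    show "x \<in> cball x0 (\<rho>/2) \<and> y \<in> cball y0 (\<rho>/2)" if "W x y > 0" for x y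
    proof -
      have "\<epsilon> * ((x - x0) \<bullet> (x - x0)) \<le> t" "\<epsilon> * ((y - y0) \<bullet> (y - y0)) \<le> t"
        using that \<Phi>max[of x y] nn[of "x - x0"] nn[of "y - y0"] by (auto simp: W_def)
      then have "(norm (x - x0))\<^sup>2 \<le> (\<rho>/2)\<^sup>2" "(norm (y - y0))\<^sup>2 \<le> (\<rho>/2)\<^sup>2"
        using \<epsilon> unfolding t_def by (simp_all add: dot_square_norm)
      then have "norm (x - x0) \<le> \<rho>/2" "norm (y - y0) \<le> \<rho>/2"
        using \<rho> by (auto intro: power2_le_imp_le)
      then show ?thesis by (simp add: dist_norm norm_minus_commute)
    qed
    show "((\<lambda>x. W x y) has_derivative (\<lambda>h. (Du x - P x y) \<bullet> h)) (at x)"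
      if "x \<in> ball x0 \<rho>" "y \<in> ball y0 \<rho>" for x y
      unfolding W_def using has_derivative_diff[OF \<Phi>x[OF good(1)[OF that]] has_derivative_const] by simp
    show "(W x has_derivative (\<lambda>h. (Q x y - Du y) \<bullet> h)) (at y)"
      if "x \<in> ball x0 \<rho>" "y \<in> ball y0 \<rho>" for x y
      unfolding W_def[abs_def] using has_derivative_diff[OF \<Phi>y[OF good(1)[OF that]] has_derivative_const] by simp
    show "continuous_on (ball x0 \<rho> \<times> ball y0 \<rho>) (\<lambda>z. W (fst z) (snd z))"
      unfolding W_def by (intro continuous_intros c\<Phi> XYG)
    show "((\<lambda>x. Q x y) has_derivative Z x y) (at x)"
      if "x \<in> ball x0 \<rho>" "y \<in> ball y0 \<rho>" for x y
    proof -
      have "((\<lambda>x. power_field \<alpha> (x - y)) has_derivative power_field_deriv \<alpha> (x - y)) (at x)"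
        using has_derivative_compose[OF zder(1) has_derivative_power_field] good(1)[OF that] by simp
      then have "((\<lambda>x. Q x y) has_derivative (\<lambda>h. (\<kappa> * \<alpha>) *\<^sub>R power_field_deriv \<alpha> (x - y) h - 0)) (at x)"
        unfolding Q_def by (intro has_derivative_diff has_derivative_scaleR_right has_derivative_const)
      then show ?thesis by (simp add: Z_def[abs_def])
    qed
    show "((\<lambda>x. ?A (P x y)) has_derivative AP x y) (at x)"
      if "x \<in> ball x0 \<rho>" "y \<in> ball y0 \<rho>" for x y
    proof -
      have "((\<lambda>x. power_field \<alpha> (x - y)) has_derivative power_field_deriv \<alpha> (x - y)) (at x)"
        using has_derivative_compose[OF zder(1) has_derivative_power_field] good(1)[OF that] by simp
      then have "((\<lambda>x. P x y) has_derivative (\<lambda>h. (\<kappa> * \<alpha>) *\<^sub>R power_field_deriv \<alpha> (x - y) h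
          + (2 * \<epsilon>) *\<^sub>R h + (2 * \<epsilon>) *\<^sub>R h)) (at x)"
        unfolding P_def
        by (intro has_derivative_add has_derivative_scaleR_right has_derivative_ident zder)
      from has_derivative_compose[OF this has_derivative_pq_field[OF good(7)[OF that]]]
      show ?thesis
        by (simp add: AP_def[abs_def] Z_def add.assoc flip: scaleR_add_left)
    qed
    show "((\<lambda>y. ?A (Q x y)) has_derivative AQ x y) (at y)"
      if "x \<in> ball x0 \<rho>" "y \<in> ball y0 \<rho>" for x y
    proof -
      note D = has_derivative_power_field[of "x - y" \<alpha>]
      have xy': "x - y \<noteq> 0" using good(1)[OF that] by simp
      have "((\<lambda>y. power_field \<alpha> (x - y)) has_derivative (\<lambda>h. power_field_deriv \<alpha> (x - y) (- h))) (at y)"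
        using has_derivative_compose[OF zder(2) has_derivative_power_field] xy' by simp
      then have "((\<lambda>y. power_field \<alpha> (x - y)) has_derivative (\<lambda>h. - power_field_deriv \<alpha> (x - y) h)) (at y)"
        by (simp add: linear_neg[OF has_derivative_linear[OF D[OF xy']]])
      then have "((\<lambda>y. Q x y) has_derivative (\<lambda>h. (\<kappa> * \<alpha>) *\<^sub>R (- power_field_deriv \<alpha> (x - y) h)
          - (2 * \<epsilon>) *\<^sub>R h)) (at y)"
        unfolding Q_def
        by (intro has_derivative_diff has_derivative_scaleR_right zder)
      from has_derivative_compose[OF this has_derivative_pq_field[OF good(8)[OF that]]]
      show ?thesis
        by (simp add: AQ_def[abs_def] Z_def)
    qed
    show "(?A (Du x) - ?A (P x y)) \<bullet> (Du x - P x y) + 2 * (B (Q x y - Du y) \<bullet> (Du x - P x y))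
        + (?A (Q x y) - ?A (Du y)) \<bullet> (Q x y - Du y) \<ge> 0"
      if "x \<in> ball x0 \<rho>" "y \<in> ball y0 \<rho>" for x y
      unfolding B_def
      by (rule reflection_coupling_nonneg[OF e \<delta>(2,3)]; intro mono good[OF that])
    show "F x - F y + (\<Sum>b\<in>Basis. AP x y b \<bullet> b) - 2 * (\<Sum>b\<in>Basis. B (Z x y b) \<bullet> b)
        - (\<Sum>b\<in>Basis. AQ x y b \<bullet> b) < 0"
      if "x \<in> ball x0 \<rho>" "y \<in> ball y0 \<rho>" for x y
      using good(6)[OF that] by (simp add: N_def)
  qed (use weak cDu cF B XY1 XYG in \<open>auto intro!: cP cQ cZ cAP cAQ continuous_on_pq_field p q\<close>)
qed

section \<open>The Liouville theorem\<close>

text \<open>If \<open>u a > u b\<close>, parameters are fixed in the order \<delta>, \<tau>,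
  \<kappa>, \<epsilon>. The position of the maximum is known only after \<epsilon>, so the choice of
  \<epsilon> relies on bounds valid for every possible distance \<open>r \<le> L\<close>.\<close>

lemma bounded_weak_solution_le:
  fixes u :: "'a::euclidean_space \<Rightarrow> real" and Du :: "'a \<Rightarrow> 'a" and p q m G U :: real
  assumes p: "p > 1" and q: "q > 1" and m: "m > q"
    and du: "\<And>x. (u has_derivative (\<lambda>h. Du x \<bullet> h)) (at x)"
    and cDu: "continuous_on UNIV Du" and cF: "continuous_on UNIV F"
    and F: "\<And>x. \<bar>F x\<bar> \<le> G * norm (Du x) powr m"
    and U: "\<And>x. \<bar>u x\<bar> \<le> U"
    and weak: "\<And>\<phi> D\<phi>. \<lbrakk>\<And>x. (\<phi> has_derivative (\<lambda>h. D\<phi> x \<bullet> h)) (at x); continuous_on UNIV D\<phi>;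
        compact (closure {x. \<phi> x \<noteq> 0})\<rbrakk>
        \<Longrightarrow> (\<integral>x. pq_field p q (Du x) \<bullet> D\<phi> x \<partial>lborel) = (\<integral>x. F x * \<phi> x \<partial>lborel)"
  shows "u a \<le> u b"
proof (rule ccontr)
  assume "\<not> u a \<le> u b"
  define \<theta> where "\<theta> = u a - u b"
  have \<theta>: "\<theta> > 0" using \<open>\<not> u a \<le> u b\<close> by (simp add: \<theta>_def)
  then have U0: "U > 0" using U[of a] U[of b] by (simp add: \<theta>_def)
  \<comment> \<open>The identity \<open>(\<alpha> - 1) * \<beta> = - 1\<close> is what gives
    \<open>w powr m\<close> the same order \<open>w powr (q - 1) / r\<close> as the gain from the
    concave penalty.\<close>
  define \<beta> where "\<beta> = m - q + 1"
  define \<alpha> where "\<alpha> = 1 - 1 / \<beta>"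
  have \<beta>: "\<beta> > 1" using m by (simp add: \<beta>_def)
  then have \<alpha>: "0 < \<alpha>" "\<alpha> < 1" and \<alpha>\<beta>: "(\<alpha> - 1) * \<beta> = - 1" by (simp_all add: \<alpha>_def field_simps)
  let ?N = "real DIM('a)"
  have N: "?N \<ge> 1" by (simp add: Suc_leI)
  \<comment> \<open>\<open>c\<close> is an ellipticity ratio: it gives \<open>c * S \<le> T\<close>
    for every \<open>w\<close>. The value of \<delta> below is tuned so that
    \<open>6 * ?N * \<delta> = c * (1 - \<alpha>)\<close>.\<close>
  define c where "c = min 1 (min (p - 1) (q - 1))"
  have c: "0 < c" "c \<le> 1" "c \<le> q - 1" "c \<le> p - 1" using p q by (auto simp: c_def)
  define \<delta> where "\<delta> = c * (1 - \<alpha>) / (6 * ?N)"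
  have \<delta>: "\<delta> > 0" using c \<alpha> N by (simp add: \<delta>_def)
  have \<delta>N: "6 * ?N * \<delta> = c * (1 - \<alpha>)" using N by (simp add: \<delta>_def)
  have "6 * \<delta> \<le> 6 * ?N * \<delta>" using N \<delta> by simp
  moreover have "c * (1 - \<alpha>) \<le> c * 1" using c \<alpha> by (intro mult_left_mono) auto
  ultimately have \<delta>c: "6 * \<delta> \<le> c" using \<delta>N by linarith
  obtain \<tau> where \<tau>: "0 < \<tau>" "\<tau> < 1"
    "\<And>w (e::'a) \<xi> v. \<lbrakk>w > 0; norm e = 1; norm (\<xi> - w *\<^sub>R e) \<le> \<tau> * w\<rbrakk>
      \<Longrightarrow> norm (pq_field_deriv p q \<xi> v - pq_field_deriv p q (w *\<^sub>R e) v)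
        \<le> \<delta> * (w powr (p - 2) + w powr (q - 2)) * norm v"
    using pq_field_deriv_uniform_cone[OF \<delta>, where 'a = 'a and p = p and q = q] by metis
  \<comment> \<open>The first smallness condition keeps the doubled function positive at
    \<open>(a, b)\<close>; the second lets the gain absorb the right-hand sides.\<close>
  obtain \<kappa> where \<kappa>: "\<kappa> > 0" "\<kappa> * norm (a - b) powr \<alpha> < \<theta> / 2"
    "G * (2 powr m + 1) * (\<kappa> * \<alpha>) powr \<beta> < 2 * (1 - \<alpha>) * (q - 1)"
  proof -
    have "((\<lambda>\<kappa>. \<kappa> * norm (a - b) powr \<alpha>) \<longlongrightarrow> 0 * norm (a - b) powr \<alpha>) (at_right 0)"
      by (intro tendsto_intros)
    then have "\<forall>\<^sub>F \<kappa> in at_right 0. \<kappa> * norm (a - b) powr \<alpha> < \<theta> / 2"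
      by (rule order_tendstoD) (use \<theta> in simp)
    moreover have "((\<lambda>\<kappa>. (\<kappa> * \<alpha>) powr \<beta>) \<longlongrightarrow> (0 * \<alpha>) powr \<beta>) (at_right 0)"
    proof (rule tendsto_powr')
      have "\<forall>\<^sub>F x in at_right 0. 0 \<le> x * \<alpha>"
        using eventually_at_right_less[of "0::real"] by eventually_elim (use \<alpha> in simp)
      then show "0 * \<alpha> \<noteq> 0 \<or> 0 < \<beta> \<and> (\<forall>\<^sub>F x in at_right 0. 0 \<le> x * \<alpha>)" using \<beta> by simp
    qed (intro tendsto_intros)+
    then have "((\<lambda>\<kappa>. G * (2 powr m + 1) * (\<kappa> * \<alpha>) powr \<beta>) \<longlongrightarrow> G * (2 powr m + 1) * (0 * \<alpha>) powr \<beta>) (at_right 0)"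
      by (rule tendsto_mult_left)
    then have "\<forall>\<^sub>F \<kappa> in at_right 0. G * (2 powr m + 1) * (\<kappa> * \<alpha>) powr \<beta> < 2 * (1 - \<alpha>) * (q - 1)"
      by (rule order_tendstoD) (use \<alpha> q in simp)
    moreover have "\<forall>\<^sub>F \<kappa> in at_right (0::real). 0 < \<kappa>" by (rule eventually_at_right_less)
    ultimately have "\<forall>\<^sub>F \<kappa> in at_right 0. \<kappa> > 0 \<and> \<kappa> * norm (a - b) powr \<alpha> < \<theta> / 2
        \<and> G * (2 powr m + 1) * (\<kappa> * \<alpha>) powr \<beta> < 2 * (1 - \<alpha>) * (q - 1)"
      by eventually_elim simp
    then show thesis using that eventually_happens' trivial_limit_at_right_real by blast
  qed
  \<comment> \<open>\<open>L\<close> bounds the distance of the two points at the maximum, because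
    the penalty cannot exceed the oscillation \<open>2 * U\<close>. As \<alpha> - 1 is negative,
    \<open>w1\<close> is then a lower bound for \<open>w\<close>.\<close>
  define L where "L = (2 * U / \<kappa>) powr (1 / \<alpha>)"
  have L: "L > 0" using U0 \<kappa> by (simp add: L_def)
  define w1 where "w1 = \<kappa> * \<alpha> * L powr (\<alpha> - 1)"
  have w1: "w1 > 0" using \<kappa> \<alpha> L by (simp add: w1_def)
  \<comment> \<open>In turn: positivity at \<open>(a, b)\<close>, smallness of the gradient
    \<open>2 * \<epsilon> * norm x0\<close> against \<tau> * w, and smallness of \<epsilon> against
    \<delta> * \<mu>.\<close>
  obtain \<epsilon> where \<epsilon>: "\<epsilon> > 0" "\<epsilon> * (a \<bullet> a) < \<theta> / 2" "\<epsilon> * 8 * U < (\<tau> * w1)\<^sup>2" "\<epsilon> < \<delta> * (w1 / L)"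
  proof -
    have *: "\<forall>\<^sub>F \<epsilon> in at_right 0. \<epsilon> * k < l" if "0 < l" for k l :: real
    proof -
      have "((\<lambda>\<epsilon>. \<epsilon> * k) \<longlongrightarrow> 0 * k) (at_right 0)" by (intro tendsto_intros)
      then show ?thesis by (rule order_tendstoD) (use that in simp)
    qed
    have "\<forall>\<^sub>F \<epsilon> in at_right 0. \<epsilon> * (a \<bullet> a) < \<theta> / 2" by (rule *) (use \<theta> in simp)
    moreover have "\<forall>\<^sub>F \<epsilon> in at_right 0. \<epsilon> * (8 * U) < (\<tau> * w1)\<^sup>2" by (rule *) (use \<tau> w1 in simp)
    moreover have "\<forall>\<^sub>F \<epsilon> in at_right 0. \<epsilon> * 1 < \<delta> * (w1 / L)" by (rule *) (use \<delta> w1 L in simp)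
    moreover have "\<forall>\<^sub>F \<epsilon> in at_right (0::real). 0 < \<epsilon>" by (rule eventually_at_right_less)
    ultimately have "\<forall>\<^sub>F \<epsilon> in at_right 0. \<epsilon> > 0 \<and> \<epsilon> * (a \<bullet> a) < \<theta> / 2 \<and> \<epsilon> * 8 * U < (\<tau> * w1)\<^sup>2 \<and> \<epsilon> < \<delta> * (w1 / L)"
      by eventually_elim (simp add: mult.assoc)
    then show thesis using that eventually_happens' trivial_limit_at_right_real by blast
  qed
  define J where "J z = u (fst z) - u (snd z) - \<kappa> * norm (fst z - snd z) powr \<alpha> - \<epsilon> * (fst z \<bullet> fst z)" for z
  have Jab: "J (a, b) > 0" using \<kappa>(2) \<epsilon>(2) by (simp add: J_def \<theta>_def)
  have cu: "continuous_on UNIV u"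
    by (rule has_derivative_continuous_on[OF has_derivative_at_withinI[OF du]])
  have cJ: "continuous_on A J" for A
    unfolding J_def using \<alpha>
    by (intro continuous_intros continuous_on_compose2[OF cu] continuous_on_powr') auto
  have J_small: "norm (fst z - snd z) \<le> L" "\<epsilon> * (fst z \<bullet> fst z) \<le> 2 * U" if "J z \<ge> J (a, b)" for z
  proof -
    have "u (fst z) - u (snd z) \<le> 2 * U" using U[of "fst z"] U[of "snd z"] by linarith
    moreover have "\<kappa> * norm (fst z - snd z) powr \<alpha> \<ge> 0" "\<epsilon> * (fst z \<bullet> fst z) \<ge> 0" using \<kappa> \<epsilon> by auto
    ultimately have "\<kappa> * norm (fst z - snd z) powr \<alpha> \<le> 2 * U" "\<epsilon> * (fst z \<bullet> fst z) \<le> 2 * U"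
      using that Jab unfolding J_def by linarith+
    then have "norm (fst z - snd z) powr \<alpha> \<le> 2 * U / \<kappa>" using \<kappa> by (simp add: field_simps)
    then have "(norm (fst z - snd z) powr \<alpha>) powr (1 / \<alpha>) \<le> L"
      unfolding L_def by (rule powr_mono2[rotated 2]) (use \<alpha> in auto)
    then show "norm (fst z - snd z) \<le> L" using \<alpha> by (simp add: powr_powr)
    show "\<epsilon> * (fst z \<bullet> fst z) \<le> 2 * U" by fact
  qed
  \<comment> \<open>This superlevel set is compact: the quadratic penalty bounds x and
    \<open>L\<close> bounds the distance of y from x. Hence a global maximum exists.\<close>
  let ?D = "{z. J (a, b) \<le> J z}"
  obtain x0 y0 where max: "\<And>z. J z \<le> J (x0, y0)" and J0: "J (a, b) \<le> J (x0, y0)"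
  proof -
    define R where "R = sqrt (2 * U / \<epsilon>)"
    have "?D \<subseteq> cball 0 R \<times> cball 0 (R + L)"
    proof
      fix z assume "z \<in> ?D"
      then have z: "norm (fst z - snd z) \<le> L" "\<epsilon> * (fst z \<bullet> fst z) \<le> 2 * U" using J_small by auto
      then have "(norm (fst z))\<^sup>2 \<le> 2 * U / \<epsilon>" using \<epsilon>(1) by (simp add: dot_square_norm field_simps)
      then have "norm (fst z) \<le> R" unfolding R_def by (simp add: real_le_rsqrt)
      moreover have "norm (snd z) \<le> norm (fst z) + norm (fst z - snd z)"
        by (metis norm_minus_commute norm_triangle_sub)
      ultimately show "z \<in> cball 0 R \<times> cball 0 (R + L)" using z by (auto simp: mem_Times_iff)
    qed
    then have "bounded ?D" by (rule bounded_subset[rotated]) (intro bounded_Times bounded_cball)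
    moreover have "closed ?D" by (intro closed_Collect_le continuous_on_const cJ)
    ultimately have "compact ?D" by (simp add: compact_eq_bounded_closed)
    then obtain z0 where "z0 \<in> ?D" "\<And>z. z \<in> ?D \<Longrightarrow> J z \<le> J z0"
      using continuous_attains_sup[of ?D J] cJ by (metis (mono_tags) empty_iff mem_Collect_eq order_refl)
    then show thesis using that[of "fst z0" "snd z0"] by (metis le_cases mem_Collect_eq order_trans prod.collapse)
  qed
  \<comment> \<open>On the diagonal \<open>J\<close> is nonpositive, whereas its maximum is
    positive.\<close>
  have ne: "x0 \<noteq> y0"
  proof
    assume "x0 = y0"
    then have "J (x0, y0) = - (\<epsilon> * (x0 \<bullet> x0))" by (simp add: J_def)
    also have "\<dots> \<le> 0" using \<epsilon> by simp
    finally show False using Jab J0 by linarith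
  qed
  define r where "r = norm (x0 - y0)"
  define w where "w = \<kappa> * \<alpha> * r powr (\<alpha> - 1)"
  define S where "S = w powr (p - 2) + w powr (q - 2)"
  define T where "T = (p - 1) * w powr (p - 2) + (q - 1) * w powr (q - 2)"
  define \<mu> where "\<mu> = w / r"
  have r: "0 < r" "r \<le> L" using ne J_small(1)[OF J0] by (auto simp: r_def)
  have "w1 \<le> w"
    unfolding w1_def w_def using r \<alpha> \<kappa> by (intro mult_left_mono powr_mono2') auto
  then have w: "w1 \<le> w" "w > 0" using w1 by auto
  have \<mu>: "w1 / L \<le> \<mu>" unfolding \<mu>_def using r w w1 by (intro frac_le) auto
  have \<mu>0: "\<mu> > 0" using w r by (simp add: \<mu>_def)
  have wp: "w powr s > 0" for s using w by simp
  have S: "S > 0" using wp by (simp add: S_def add_pos_pos)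
  have cST: "c * S \<le> T"
    unfolding S_def T_def distrib_left using c by (intro add_mono mult_right_mono) auto
  have \<epsilon>\<mu>: "\<epsilon> \<le> \<delta> * \<mu>"
    using \<epsilon>(4) mult_left_mono[OF \<mu> less_imp_le[OF \<delta>]] by linarith
  have T0: "T > 0" using cST S c by (smt (verit) mult_pos_pos)
  show False
  proof (rule no_weak_two_point_maximum[OF p q du cDu cF weak \<alpha> \<kappa>(1) \<epsilon>(1) ne _ w_def[unfolded r_def]
        S_def T_def \<mu>_def[unfolded r_def] \<delta> _ _ _ \<tau>(2)])
    show "u x - u y - \<kappa> * norm (x - y) powr \<alpha> - \<epsilon> * (x \<bullet> x)
        \<le> u x0 - u y0 - \<kappa> * norm (x0 - y0) powr \<alpha> - \<epsilon> * (x0 \<bullet> x0)" for x y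
      using max[of "(x, y)"] by (simp add: J_def)
    have "\<delta> * S \<le> 1 * S" using \<delta> \<delta>c c S by (intro mult_right_mono) auto
    then show "\<delta> * S \<le> S" by simp
    have "\<delta> * S \<le> c * S" using \<delta> \<delta>c c S by (intro mult_right_mono) auto
    then show "\<delta> * S \<le> T" using cST by linarith
    have "6 * ?N * (\<delta> * S) = (1 - \<alpha>) * (c * S)" using \<delta>N by (metis mult.assoc mult.commute)
    also have "\<dots> \<le> (1 - \<alpha>) * T" using cST \<alpha> by (intro mult_left_mono) auto
    finally show "6 * ?N * (\<delta> * S) \<le> (1 - \<alpha>) * T" .
    show "norm (pq_field_deriv p q \<xi> v - pq_field_deriv p q (w *\<^sub>R e) v) \<le> \<delta> * S * norm v"
      if "norm e = 1" "norm (\<xi> - w *\<^sub>R e) \<le> \<tau> * w" for e \<xi> v :: 'a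
      using \<tau>(3)[OF w(2) that] by (simp add: S_def)
    have "4 * (\<delta> * \<mu>) \<le> 1 * \<mu>"
      using \<delta>c c(2) \<delta> \<mu>0 by (simp flip: mult.assoc)
    then show "4 * \<epsilon> \<le> \<mu>" using \<epsilon>\<mu> by linarith
    \<comment> \<open>\<open>S\<close> is controlled by \<open>T\<close> only through
      \<open>c * S \<le> T\<close>, so the inequality is proved after multiplication by
      \<open>c\<close>, which is cancelled at the end.\<close>
    have "c * (S * (?N - 1) + T) = (c * S) * (?N - 1) + c * T" by (simp add: algebra_simps)
    also have "\<dots> \<le> T * (?N - 1) + 1 * T"
      using cST N c T0 by (intro add_mono mult_right_mono) auto
    finally have 1: "c * (S * (?N - 1) + T) \<le> ?N * T" by (simp add: algebra_simps)
    have ST: "0 \<le> S * (?N - 1) + T" using S N T0 by simp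
    have "c * (6 * \<epsilon> * (S * (?N - 1) + T)) = (6 * \<epsilon>) * (c * (S * (?N - 1) + T))" by simp
    also have "\<dots> \<le> (6 * (\<delta> * \<mu>)) * (?N * T)"
      by (rule mult_mono[OF _ 1]) (use \<epsilon>\<mu> \<epsilon>(1) \<delta> \<mu>0 c ST in auto)
    also have "\<dots> = (6 * ?N * \<delta>) * T * \<mu>" by simp
    also have "\<dots> = c * ((1 - \<alpha>) * T * \<mu>)" unfolding \<delta>N by simp
    finally show "6 * \<epsilon> * (S * (?N - 1) + T) \<le> (1 - \<alpha>) * T * \<mu>"
      using c(1) by (rule mult_left_le_imp_le)
    have "(2 * \<epsilon> * norm x0)\<^sup>2 = 4 * \<epsilon> * (\<epsilon> * (x0 \<bullet> x0))"
      by (simp add: dot_square_norm power2_eq_square)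
    also have "\<dots> \<le> 4 * \<epsilon> * (2 * U)"
      using J_small(2)[OF J0] \<epsilon>(1) by (intro mult_left_mono) auto
    also have "\<dots> < (\<tau> * w1)\<^sup>2" using \<epsilon>(3) by simp
    finally have "2 * \<epsilon> * norm x0 < \<tau> * w1"
      by (rule power_less_imp_less_base) (use \<tau> w1 in simp)
    also have "\<dots> \<le> \<tau> * w" using w \<tau> by simp
    finally show "2 * \<epsilon> * norm x0 < \<tau> * w" .
    show "F x0 - F y0 < 2 * (1 - \<alpha>) * T * \<mu>" if D: "norm (Du x0) \<le> 2 * w" "norm (Du y0) \<le> w"
    proof -
      have Fx: "\<bar>F x\<bar> \<le> max G 0 * s powr m" if "norm (Du x) \<le> s" for x s
      proof -
        have "G * norm (Du x) powr m \<le> max G 0 * s powr m"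
          using that m q by (intro mult_mono powr_mono2) auto
        then show ?thesis using F[of x] by linarith
      qed
      have "F x0 - F y0 \<le> max G 0 * (2 * w) powr m + max G 0 * w powr m"
        using Fx[OF D(1)] Fx[OF D(2)] by linarith
      also have "\<dots> = max G 0 * (2 powr m + 1) * w powr m"
        using w by (simp add: powr_mult algebra_simps)
      \<comment> \<open>Here \<open>m = (q - 1) + \<beta>\<close>, and the factor
        \<open>w powr \<beta>\<close> becomes \<open>(\<kappa> * \<alpha>) powr \<beta> / r\<close>,
        with a coefficient made small by \<kappa>.\<close>
      also have "w powr m = w powr (q - 1) * w powr \<beta>"
        by (simp add: \<beta>_def flip: powr_add)
      also have "w powr \<beta> = (\<kappa> * \<alpha>) powr \<beta> / r"
        using \<kappa> \<alpha> r by (simp add: w_def powr_mult powr_powr \<alpha>\<beta> powr_minus_divide)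
      also have "max G 0 * (2 powr m + 1) * (w powr (q - 1) * ((\<kappa> * \<alpha>) powr \<beta> / r))
          = (max G 0 * (2 powr m + 1) * (\<kappa> * \<alpha>) powr \<beta>) * (w powr (q - 1) / r)" by simp
      also have "\<dots> < (2 * (1 - \<alpha>) * (q - 1)) * (w powr (q - 1) / r)"
        using \<kappa>(3) \<alpha> q r wp by (intro mult_strict_right_mono) (auto simp: max_def)
      also have "\<dots> = 2 * (1 - \<alpha>) * ((q - 1) * w powr (q - 2)) * \<mu>"
      proof -
        have "w powr (q - 1) = w powr (q - 2) * w"
          using powr_add[of w "q - 2" 1] w by simp
        then show ?thesis by (simp add: \<mu>_def)
      qed
      \<comment> \<open>The q-part of \<open>T\<close> already suffices, and the p-part is
        nonnegative.\<close>
      also have "\<dots> \<le> 2 * (1 - \<alpha>) * T * \<mu>"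
        using p \<alpha> \<mu>0 by (intro mult_right_mono mult_left_mono) (auto simp: T_def)
      finally show ?thesis .
    qed
  qed
qed

theorem theorem1p3:
  fixes p q m :: real
    and g :: "real \<Rightarrow> real"
    and f :: "real \<Rightarrow> real^'n \<Rightarrow> real"
    and u :: "real^'n \<Rightarrow> real"
    and Du :: "real^'n \<Rightarrow> real^'n"
  assumes "CARD('n) \<ge> 2"
    and "p > q" and "q > 1" and "m > q"
    and "continuous_on UNIV g"
    and "continuous_on UNIV (\<lambda>(t, \<xi>). f t \<xi>)"
    and "\<And>t \<xi>. \<bar>f t \<xi>\<bar> \<le> g t * norm \<xi> powr m"
    and "pq_laplace_solution p q f u Du"
    and "bounded (range u)"
  shows "\<exists>c. \<forall>x. u x = c"
proof -
  have p: "p > 1" using assms(2,3) by simp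
  have du: "(u has_derivative (\<lambda>h. Du x \<bullet> h)) (at x)" for x
    using assms(8) by (auto simp: pq_laplace_solution_def C1_with_grad_def)
  have cDu: "continuous_on UNIV Du"
    using assms(8) by (auto simp: pq_laplace_solution_def C1_with_grad_def)
  obtain U where U: "\<And>x. \<bar>u x\<bar> \<le> U"
    using assms(9) by (auto simp: bounded_iff)
  \<comment> \<open>Boundedness of \<open>u\<close> confines the argument of \<open>g\<close> to a
    compact interval, which turns the growth condition into one with a constant
    \<open>G\<close>.\<close>
  have "compact (g ` {-U..U})"
    by (intro compact_continuous_image continuous_on_subset[OF assms(5)]) auto
  then obtain G where "\<forall>s\<in>{-U..U}. \<bar>g s\<bar> \<le> G"
    by (auto dest!: compact_imp_bounded simp: bounded_iff)
  moreover have "u x \<in> {-U..U}" for x using U[of x] by auto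
  ultimately have G: "g (u x) \<le> G" for x by (metis abs_le_D1)
  have F: "\<bar>f (u x) (Du x)\<bar> \<le> G * norm (Du x) powr m" for x
    using assms(7)[of "u x" "Du x"] mult_right_mono[OF G[of x], of "norm (Du x) powr m"] by simp
  have cu: "continuous_on UNIV u"
    by (rule has_derivative_continuous_on[OF has_derivative_at_withinI[OF du]])
  have "continuous_on UNIV (\<lambda>x. (\<lambda>(t, \<xi>). f t \<xi>) (u x, Du x))"
    by (rule continuous_on_compose2[OF assms(6)]) (auto intro!: continuous_intros cu cDu)
  then have cF: "continuous_on UNIV (\<lambda>x. f (u x) (Du x))" by simp
  \<comment> \<open>Merging the two flux integrals into one requires integrability, which follows
    from continuity of the fields and from \<open>D\<phi>\<close> vanishing off the support of
    \<phi>.\<close>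
  have weak: "(\<integral>x. pq_field p q (Du x) \<bullet> D\<phi> x \<partial>lborel) = (\<integral>x. f (u x) (Du x) * \<phi> x \<partial>lborel)"
    if \<phi>: "\<And>x. (\<phi> has_derivative (\<lambda>h. D\<phi> x \<bullet> h)) (at x)" "continuous_on UNIV D\<phi>"
      "compact (closure {x. \<phi> x \<noteq> 0})" for \<phi> :: "real^'n \<Rightarrow> real" and D\<phi>
  proof -
    let ?K = "closure {x. \<phi> x \<noteq> 0}"
    have "D\<phi> x = 0" if "x \<notin> ?K" for x
    proof -
      have "\<phi> y = 0" if "y \<notin> ?K" for y using closure_subset[of "{x. \<phi> x \<noteq> 0}"] that by auto
      then have "(\<lambda>h. D\<phi> x \<bullet> h) = (\<lambda>h. 0)"
        using has_derivative_unique[OF \<phi>(1) has_derivative_zero_outside[OF closed_closure _ that]] by blast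
      then show ?thesis by (metis inner_eq_zero_iff)
    qed
    then have "integrable lborel (\<lambda>x. power_field s (Du x) \<bullet> D\<phi> x)" if "s > 1" for s
      using that
      by (intro integrable_compact_support[OF \<phi>(3)] continuous_intros
          continuous_on_compose2[OF continuous_on_power_field[OF that, of UNIV]])
        (auto intro: continuous_on_subset[OF cDu] continuous_on_subset[OF \<phi>(2)])
    then have "(\<integral>x. pq_field p q (Du x) \<bullet> D\<phi> x \<partial>lborel)
        = (\<integral>x. power_field p (Du x) \<bullet> D\<phi> x \<partial>lborel) + (\<integral>x. power_field q (Du x) \<bullet> D\<phi> x \<partial>lborel)"
      using p assms(3) by (simp add: pq_field_def inner_add_left)
    moreover have "C1c_test \<phi> D\<phi>" using \<phi> by (simp add: C1c_test_def C1_with_grad_def)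
    ultimately show ?thesis
      using assms(8) by (simp add: pq_laplace_solution_def power_field_def)
  qed
  \<comment> \<open>Both points are arbitrary, so exchanging them gives equality.\<close>
  have "u a \<le> u b" for a b
    by (rule bounded_weak_solution_le[OF p assms(3,4) du cDu cF F U weak])
  then have "u x = u 0" for x by (simp add: order.eq_iff)
  then show ?thesis by blast
qed

end
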